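(* Let $b_+,b_->0$, $\delta_\pm\in\mathbb R$ with $b_\pm+\delta_\pm>0$ and $\delta_+\delta_-<0$, and $c>0$. Then there is a nonzero real constant $E^{(1)}_{\mathrm{II}}$, determined by $(b_\pm,\delta_\pm,c)$, such that for all sufficiently small but nonzero $|k|$ the type-II interface Hamiltonian $\hat H_{\mathrm{II}}(k)$ (defined in the context) has two distinct eigenvalues $E_{\mathrm{II},+}(k)$, $E_{\mathrm{II},-}(k)$ satisfying $$E_{\mathrm{II},\pm}(k)=\pm E^{(1)}_{\mathrm{II}}|k|+\mathcal O(k^2).$$
   Context: Coefficients: for $n\in\mathbb Z$ let $b_n=b_+$ for $n\ge0$ and $b_n=b_-$ for $n\le-1$; $c_n=b_++\delta_+$ for $n\ge0$, $c_{-1}=c$, $c_n=b_-+\delta_-$ for $n\le-2$; $d_n=b_++\delta_+$ for $n\ge0$, $d_{-1}=d_{-2}=c$, $d_n=b_-+\delta_-$ for $n\le-3$. For $k\in[-\pi,\pi)$, $\hat H_{\mathrm{II}}(k)$ is the bounded self-adjoint operator on $\ell^2(\mathbb Z;\mathbb C^6)$ acting on $w=\{(w_{j,n})_{j=1}^6\}_{n\in\mathbb Z}$ by $(\hat H_{\mathrm{II}}(k)w)_{1,n}=-b_nw_{4,n}-b_nw_{5,n}-c_ne^{-ik}w_{6,n+1}$, $(\hat H_{\mathrm{II}}(k)w)_{2,n}=-b_nw_{4,n}-d_{n-2}e^{ik}w_{5,n-2}-b_nw_{6,n}$, $(\hat H_{\mathrm{II}}(k)w)_{3,n}=-c_nw_{4,n+1}-b_nw_{5,n}-b_nw_{6,n}$,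 $(\hat H_{\mathrm{II}}(k)w)_{4,n}=-b_nw_{1,n}-b_nw_{2,n}-c_{n-1}w_{3,n-1}$, $(\hat H_{\mathrm{II}}(k)w)_{5,n}=-b_nw_{1,n}-d_ne^{-ik}w_{2,n+2}-b_nw_{3,n}$, $(\hat H_{\mathrm{II}}(k)w)_{6,n}=-c_{n-1}e^{ik}w_{1,n-1}-b_nw_{2,n}-b_nw_{3,n}$. *)

theory Defs
  imports "HOL-Analysis.Analysis"
begin

definition coef_b :: "real \<Rightarrow> real \<Rightarrow> int \<Rightarrow> complex" where
  "coef_b bp bm n = complex_of_real (if n \<ge> 0 then bp else bm)"

definition coef_c :: "real \<Rightarrow> real \<Rightarrow> real \<Rightarrow> real \<Rightarrow> real \<Rightarrow> int \<Rightarrow> complex" where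
  "coef_c bp bm dp dm cc n = complex_of_real
     (if n \<ge> 0 then bp + dp else if n = -1 then cc else bm + dm)"

definition coef_d :: "real \<Rightarrow> real \<Rightarrow> real \<Rightarrow> real \<Rightarrow> real \<Rightarrow> int \<Rightarrow> complex" where
  "coef_d bp bm dp dm cc n = complex_of_real
     (if n \<ge> 0 then bp + dp else if n = -1 \<or> n = -2 then cc else bm + dm)"

text \<open>Action of the type-II interface Hamiltonian \<open>\<hat>H_II(k)\<close> on a sequence
  w :: int \<Rightarrow> nat \<Rightarrow> complex, where w n j is the component w_{j,n}, j \<in> {1..6}.
  The result (H w) n j is the j-th component at site n.\<close>

definition H_II :: "real \<Rightarrow> real \<Rightarrow> real \<Rightarrow> real \<Rightarrow> real \<Rightarrow> real \<Rightarrow>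
    (int \<Rightarrow> nat \<Rightarrow> complex) \<Rightarrow> int \<Rightarrow> nat \<Rightarrow> complex" where
  "H_II bp bm dp dm cc k w n j =
    (let b = coef_b bp bm; c = coef_c bp bm dp dm cc; d = coef_d bp bm dp dm cc;
         ep = exp (\<i> * complex_of_real k); em = exp (- \<i> * complex_of_real k) in
     if j = 1 then - b n * w n 4 - b n * w n 5 - c n * em * w (n+1) 6
     else if j = 2 then - b n * w n 4 - d (n-2) * ep * w (n-2) 5 - b n * w n 6
     else if j = 3 then - c n * w (n+1) 4 - b n * w n 5 - b n * w n 6
     else if j = 4 then - b n * w n 1 - b n * w n 2 - c (n-1) * w (n-1) 3
     else if j = 5 then - b n * w n 1 - d n * em * w (n+2) 2 - b n * w n 3
     else if j = 6 then - c (n-1) * ep * w (n-1) 1 - b n * w n 2 - b n * w n 3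
     else 0)"

definition l2_C6 :: "(int \<Rightarrow> nat \<Rightarrow> complex) \<Rightarrow> bool" where
  "l2_C6 w \<longleftrightarrow> (\<lambda>n. \<Sum>j\<in>{1..6}. (cmod (w n j))\<^sup>2) summable_on (UNIV :: int set)"

definition is_eigenvalue_H_II :: "real \<Rightarrow> real \<Rightarrow> real \<Rightarrow> real \<Rightarrow> real \<Rightarrow> real \<Rightarrow> real \<Rightarrow> bool" where
  "is_eigenvalue_H_II bp bm dp dm cc k E \<longleftrightarrow>
     (\<exists>w. l2_C6 w \<and> (\<exists>n. \<exists>j\<in>{1..6}. w n j \<noteq> 0) \<and>
          (\<forall>n. \<forall>j\<in>{1..6}. H_II bp bm dp dm cc k w n j = complex_of_real E * w n j))"

end

theory Submission
  imports Defs "HOL-Probability.Discrete_Topology"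
begin

text \<open>By the reflection \<open>n \<mapsto> -1 - n\<close> we may assume \<open>\<delta>\<^sub>+ > 0 > \<delta>\<^sub>-\<close>. The Hamiltonian is chiral, so \<open>E\<close> and
  \<open>-E\<close> are eigenvalues together. In the gauge \<open>e\<^bsup>i\<kappa>n\<^esup>\<close>, \<open>\<kappa> = k / 2\<close>, the problem is real, and at \<open>k = 0\<close> it splits
  under the exchange \<open>1 \<leftrightarrow> 3\<close>, \<open>4 \<leftrightarrow> 6\<close>: one sublattice carries an odd positive zero mode \<open>f0\<close>, the other an
  even positive zero mode \<open>P0\<close>. First-order coupling of the two gives \<open>\<plusminus>E1 |k|\<close>, and \<open>E1 \<noteq> 0\<close> because the
  overlap of positive sequences is positive. The perturbation is made rigorous by a fixed point
  in a space of exponentially decaying sequences: the Green operators of the unperturbed problem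
  are built from first-order factors with explicit exponentially decaying kernels, and the two
  solvability conditions determine the eigenvalue and the relative amplitude of the two modes.\<close>

section \<open>Lipschitz maps on bounded sets and a small-parameter fixed point\<close>

text \<open>Zero is a double eigenvalue at \<open>k = 0\<close>, so correcting the two modes is
  possible only under an orthogonality condition to \<open>f0\<close> and one to \<open>P0\<close>;
  two scalars, the energy and the ratio of the amplitudes, must meet both. Scaling the even mode to
  the norm of the odd one makes the ratio \<open>1\<close> solve the leading order. With
  \<open>N\<close> the sum of the squares of \<open>f0\<close> and \<open>S\<close> the overlap of
  the modes across one bond this gives \<open>E1 = - S / (2 * N)\<close>, the \<open>2\<close>
  coming from \<open>\<kappa> = k / 2\<close>. The even mode has no closed formula, because its
  three-term recurrence has site-dependent coefficients near the interface; positivity takes the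
  place of a formula, both for the decay estimates and for \<open>S > 0\<close>. Amplitudes absent
  at \<open>k = 0\<close> are of order \<open>\<kappa>\<close>. Dividing them by
  \<open>\<kappa>\<close> leaves a system in which only \<open>\<mu> = \<kappa>\<^sup>2\<close> and
  bounded even functions of \<open>\<kappa>\<close> occur, so one estimate, uniform for small
  \<open>\<mu>\<close>, covers both signs of \<open>k\<close>. Bounded functions on a discrete copy
  of the integers supply a Banach space type for the fixed point, and exponential decay makes every
  solution square summable.\<close>

definition lip_bounded :: "('a::real_normed_vector \<Rightarrow> 'b::real_normed_vector) \<Rightarrow> bool" where
  "lip_bounded f \<longleftrightarrow>
     (\<forall>R. \<exists>L\<ge>0. \<forall>x y. norm x \<le> R \<longrightarrow> norm y \<le> R \<longrightarrow> norm (f x - f y) \<le> L * norm (x - y))"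

lemma lip_boundedE:
  assumes "lip_bounded f"
  obtains L where "L \<ge> 0"
    "\<And>x y. norm x \<le> R \<Longrightarrow> norm y \<le> R \<Longrightarrow> norm (f x - f y) \<le> L * norm (x - y)"
  using assms unfolding lip_bounded_def by blast

lemma lip_bounded_imp_bounded:
  assumes "lip_bounded f"
  obtains M where "M \<ge> 0" "\<And>x. norm x \<le> R \<Longrightarrow> norm (f x) \<le> M"
proof -
  obtain L where L: "L \<ge> 0"
    "\<And>x y. norm x \<le> \<bar>R\<bar> \<Longrightarrow> norm y \<le> \<bar>R\<bar> \<Longrightarrow> norm (f x - f y) \<le> L * norm (x - y)"
    using lip_boundedE[OF assms] by blast
  have "norm (f x) \<le> norm (f 0) + L * \<bar>R\<bar>" if "norm x \<le> R" for x
  proof -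
    have "norm (f x) \<le> norm (f 0) + norm (f x - f 0)"
      by (rule norm_triangle_sub)
    also have "norm (f x - f 0) \<le> L * norm x"
      using L(2)[of x 0] that by simp
    also have "\<dots> \<le> L * \<bar>R\<bar>"
      using that L(1) by (intro mult_left_mono) auto
    finally show ?thesis by simp
  qed
  moreover have "0 \<le> norm (f 0) + L * \<bar>R\<bar>" using L(1) by simp
  ultimately show ?thesis using that by blast
qed

lemma lip_bounded_const: "lip_bounded (\<lambda>x. c)"
  unfolding lip_bounded_def by (auto intro!: exI[of _ 0])

lemma lip_bounded_bounded_linear:
  assumes "bounded_linear T" "lip_bounded f"
  shows "lip_bounded (\<lambda>x. T (f x))"
  unfolding lip_bounded_def
proof
  fix R
  obtain L where L: "L \<ge> 0"
    "\<And>x y. norm x \<le> R \<Longrightarrow> norm y \<le> R \<Longrightarrow> norm (f x - f y) \<le> L * norm (x - y)"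
    using lip_boundedE[OF assms(2)] by blast
  obtain K where K: "K \<ge> 0" "\<And>x. norm (T x) \<le> norm x * K"
    using bounded_linear.nonneg_bounded[OF assms(1)] by blast
  have "norm (T (f x) - T (f y)) \<le> (K * L) * norm (x - y)" if "norm x \<le> R" "norm y \<le> R" for x y
  proof -
    have "norm (T (f x) - T (f y)) = norm (T (f x - f y))"
      by (simp add: linear_diff assms(1) bounded_linear.linear)
    also have "\<dots> \<le> K * norm (f x - f y)" using K(2) by (simp add: mult.commute)
    also have "\<dots> \<le> K * (L * norm (x - y))" by (intro mult_left_mono L that K)
    finally show ?thesis by (simp add: mult.assoc)
  qed
  then show "\<exists>L\<ge>0. \<forall>x y. norm x \<le> R \<longrightarrow> norm y \<le> R \<longrightarrow> norm (T (f x) - T (f y)) \<le> L * norm (x - y)"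
    using K(1) L(1) by (intro exI[of _ "K * L"]) auto
qed

lemma lip_bounded_ident: "lip_bounded (\<lambda>x. x)"
  unfolding lip_bounded_def by (auto intro!: exI[of _ 1])

lemma lip_bounded_add:
  assumes "lip_bounded f" "lip_bounded g"
  shows "lip_bounded (\<lambda>x. f x + g x)"
  unfolding lip_bounded_def
proof
  fix R
  obtain L where L: "L \<ge> 0"
    "\<And>x y. norm x \<le> R \<Longrightarrow> norm y \<le> R \<Longrightarrow> norm (f x - f y) \<le> L * norm (x - y)"
    using lip_boundedE[OF assms(1)] by blast
  obtain K where K: "K \<ge> 0"
    "\<And>x y. norm x \<le> R \<Longrightarrow> norm y \<le> R \<Longrightarrow> norm (g x - g y) \<le> K * norm (x - y)"
    using lip_boundedE[OF assms(2)] by blast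
  have "norm (f x + g x - (f y + g y)) \<le> (L + K) * norm (x - y)" if "norm x \<le> R" "norm y \<le> R" for x y
    using L(2)[OF that] K(2)[OF that]
      norm_diff_triangle_ineq[of "f x" "g x" "f y" "g y"] by (simp add: distrib_right)
  then show "\<exists>L\<ge>0. \<forall>x y. norm x \<le> R \<longrightarrow> norm y \<le> R \<longrightarrow>
      norm (f x + g x - (f y + g y)) \<le> L * norm (x - y)"
    using K(1) L(1) by (intro exI[of _ "L + K"]) auto
qed

lemma lip_bounded_minus: "lip_bounded f \<Longrightarrow> lip_bounded (\<lambda>x. - f x)"
  by (rule lip_bounded_bounded_linear[OF bounded_linear_minus[OF bounded_linear_ident]])

lemma lip_bounded_diff:
  "lip_bounded f \<Longrightarrow> lip_bounded g \<Longrightarrow> lip_bounded (\<lambda>x. f x - g x)"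
  using lip_bounded_add[OF _ lip_bounded_minus] by fastforce

text \<open>Products are the reason for asking Lipschitz bounds only on balls: the fixed-point map
  is polynomial in the unknowns, with bounded linear operators as coefficients, and is assembled
  from this rule and the linear ones.\<close>

lemma lip_bounded_bilinear:
  assumes "bounded_bilinear B" "lip_bounded f" "lip_bounded g"
  shows "lip_bounded (\<lambda>x. B (f x) (g x))"
  unfolding lip_bounded_def
proof
  fix R
  interpret B: bounded_bilinear B by fact
  obtain L where L: "L \<ge> 0"
    "\<And>x y. norm x \<le> R \<Longrightarrow> norm y \<le> R \<Longrightarrow> norm (f x - f y) \<le> L * norm (x - y)"
    using lip_boundedE[OF assms(2)] by blast
  obtain K where K: "K \<ge> 0"
    "\<And>x y. norm x \<le> R \<Longrightarrow> norm y \<le> R \<Longrightarrow> norm (g x - g y) \<le> K * norm (x - y)"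
    using lip_boundedE[OF assms(3)] by blast
  obtain M where M: "M \<ge> 0" "\<And>x. norm x \<le> R \<Longrightarrow> norm (f x) \<le> M"
    using lip_bounded_imp_bounded[OF assms(2)] by blast
  obtain N where N: "N \<ge> 0" "\<And>x. norm x \<le> R \<Longrightarrow> norm (g x) \<le> N"
    using lip_bounded_imp_bounded[OF assms(3)] by blast
  obtain Q where Q: "Q \<ge> 0" "\<And>a b. norm (B a b) \<le> norm a * norm b * Q"
    using B.nonneg_bounded by blast
  have "norm (B (f x) (g x) - B (f y) (g y)) \<le> ((L * N + M * K) * Q) * norm (x - y)"
    if xy: "norm x \<le> R" "norm y \<le> R" for x y
  proof -
    have eq: "B (f x) (g x) - B (f y) (g y) = B (f x - f y) (g x) + B (f y) (g x - g y)"
      by (simp add: B.diff_left B.diff_right)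
    have "norm (B (f x) (g x) - B (f y) (g y))
      \<le> norm (f x - f y) * norm (g x) * Q + norm (f y) * norm (g x - g y) * Q"
      using norm_triangle_ineq[of "B (f x - f y) (g x)" "B (f y) (g x - g y)"]
        Q(2)[of "f x - f y" "g x"] Q(2)[of "f y" "g x - g y"]
      unfolding eq by linarith
    also have "\<dots> \<le> (L * norm (x - y)) * N * Q + M * (K * norm (x - y)) * Q"
      by (intro add_mono mult_mono L K M N Q xy mult_nonneg_nonneg norm_ge_zero order_refl)
    finally show ?thesis by (simp add: algebra_simps)
  qed
  then show "\<exists>L\<ge>0. \<forall>x y. norm x \<le> R \<longrightarrow> norm y \<le> R \<longrightarrow>
      norm (B (f x) (g x) - B (f y) (g y)) \<le> L * norm (x - y)"
    using K(1) L(1) M(1) N(1) Q(1)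
    by (intro exI[of _ "(L * N + M * K) * Q"]) auto
qed

lemmas lip_bounded_scaleR = lip_bounded_bilinear[OF bounded_bilinear_scaleR]
lemmas lip_bounded_mult = lip_bounded_bilinear[OF bounded_bilinear_mult]
lemmas lip_bounded_fst = lip_bounded_bounded_linear[OF bounded_linear_fst]
lemmas lip_bounded_snd = lip_bounded_bounded_linear[OF bounded_linear_snd]

lemma lip_bounded_Pair:
  assumes "lip_bounded f" "lip_bounded g"
  shows "lip_bounded (\<lambda>x. (f x, g x))"
proof -
  have "bounded_linear (\<lambda>x::'b. (x, 0::'c))" "bounded_linear (\<lambda>x::'c. (0::'b, x))"
    by (auto intro: bounded_linear_intros)
  from lip_bounded_add[OF lip_bounded_bounded_linear[OF this(1) assms(1)]
      lip_bounded_bounded_linear[OF this(2) assms(2)]]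
  show ?thesis by simp
qed

text \<open>The unknown enters \<open>V\<close> only as \<open>\<mu> x\<close>, so both terms have a
  Lipschitz constant proportional to \<open>\<mu>\<close>, and the contraction principle applies on
  a ball whose radius is independent of \<open>\<mu>\<close>. The separate term \<open>W\<close>
  serves a product of two unknowns that carries a single factor \<open>\<mu>\<close>.\<close>

lemma small_parameter_fixed_point:
  fixes V :: "'p::real_normed_vector \<times> 'x::{real_normed_vector,complete_space} \<Rightarrow> 'x"
    and W :: "'x \<Rightarrow> 'x"
  assumes V: "lip_bounded V" and W: "lip_bounded W"
  obtains R \<mu>0 where "R > 0" "\<mu>0 > 0"
    "\<And>\<mu> p. 0 \<le> \<mu> \<Longrightarrow> \<mu> \<le> \<mu>0 \<Longrightarrow> norm p \<le> B \<Longrightarrow>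
       \<exists>x. norm x \<le> R \<and> V (p, \<mu> *\<^sub>R x) + \<mu> *\<^sub>R W x = x"
proof -
  obtain L where L: "L \<ge> 0"
    "\<And>x y. norm x \<le> \<bar>B\<bar> + 1 \<Longrightarrow> norm y \<le> \<bar>B\<bar> + 1 \<Longrightarrow> norm (V x - V y) \<le> L * norm (x - y)"
    using lip_boundedE[OF V] by blast
  \<comment> \<open>\<open>L\<close> is fixed on a ball that does not involve \<open>R\<close>,
    since \<open>\<mu> R \<le> 1\<close> will keep the argument of \<open>V\<close> in it. Hence
    \<open>R\<close> may use \<open>L\<close>, while \<open>K\<close> and \<open>M\<close> below may
    depend on \<open>R\<close>.\<close>
  define R where "R = norm (V 0) + L * \<bar>B\<bar> + 1"
  have R: "R > 0" unfolding R_def using L(1) by (intro add_nonneg_pos add_nonneg_nonneg) auto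
  obtain K where K: "K \<ge> 0"
    "\<And>x y. norm x \<le> R \<Longrightarrow> norm y \<le> R \<Longrightarrow> norm (W x - W y) \<le> K * norm (x - y)"
    using lip_boundedE[OF W] by blast
  obtain M where M: "M \<ge> 0" "\<And>x. norm x \<le> R \<Longrightarrow> norm (W x) \<le> M"
    using lip_bounded_imp_bounded[OF W] by blast
  \<comment> \<open>The sum of the three quantities that \<open>\<mu>\<close> has to make small: for
    the argument of \<open>V\<close>, for the ball to be mapped into itself, and for the contraction
    constant \<open>1/2\<close>.\<close>
  define A where "A = R + (L * R + M) + 2 * (L + K)"
  have A: "A > 0" "R \<le> A" "L * R + M \<le> A" "2 * (L + K) \<le> A"
    unfolding A_def using R L(1) K(1) M(1) by (auto intro!: add_pos_nonneg add_nonneg_nonneg)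
  have "\<exists>x. norm x \<le> R \<and> V (p, \<mu> *\<^sub>R x) + \<mu> *\<^sub>R W x = x"
    if mu: "0 \<le> \<mu>" "\<mu> \<le> 1 / A" and p: "norm p \<le> B" for \<mu> p
  proof -
    define T where "T x = V (p, \<mu> *\<^sub>R x) + \<mu> *\<^sub>R W x" for x
    have muA: "\<mu> * A \<le> 1" using mu A(1) by (simp add: field_simps)
    have muR: "\<mu> * R \<le> 1" using muA mult_left_mono[OF A(2) mu(1)] by linarith
    have muL: "\<mu> * (L * R + M) \<le> 1" using muA mult_left_mono[OF A(3) mu(1)] by linarith
    have muK: "\<mu> * (L + K) \<le> 1/2" using muA mult_left_mono[OF A(4) mu(1)] by linarith
    have small: "norm (p, \<mu> *\<^sub>R x) \<le> \<bar>B\<bar> + 1" if "norm x \<le> R" for x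
    proof -
      have "norm (\<mu> *\<^sub>R x) \<le> \<mu> * R" using that mu by (simp add: mult_left_mono)
      then show ?thesis using norm_Pair_le[of p "\<mu> *\<^sub>R x"] p muR by linarith
    qed
    have lip: "dist (T x) (T y) \<le> 1/2 * dist x y" if "norm x \<le> R" "norm y \<le> R" for x y
    proof -
      have "norm (V (p, \<mu> *\<^sub>R x) - V (p, \<mu> *\<^sub>R y)) \<le> L * norm ((p, \<mu> *\<^sub>R x) - (p, \<mu> *\<^sub>R y))"
        by (intro L small that)
      also have "(p, \<mu> *\<^sub>R x) - (p, \<mu> *\<^sub>R y) = (0, \<mu> *\<^sub>R (x - y))" by (simp add: scaleR_diff_right)
      also have "norm \<dots> = \<mu> * norm (x - y)" using mu by simp
      finally have 1: "norm (V (p, \<mu> *\<^sub>R x) - V (p, \<mu> *\<^sub>R y)) \<le> L * (\<mu> * norm (x - y))" .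
      have "norm (\<mu> *\<^sub>R W x - \<mu> *\<^sub>R W y) = \<mu> * norm (W x - W y)"
        using mu by (simp flip: scaleR_diff_right)
      also have "\<dots> \<le> \<mu> * (K * norm (x - y))" by (intro mult_left_mono K that mu)
      finally have "norm (T x - T y) \<le> L * (\<mu> * norm (x - y)) + \<mu> * (K * norm (x - y))"
        using 1 norm_diff_triangle_ineq[of "V (p, \<mu> *\<^sub>R x)" "\<mu> *\<^sub>R W x" "V (p, \<mu> *\<^sub>R y)" "\<mu> *\<^sub>R W y"]
        unfolding T_def by linarith
      also have "\<dots> = (\<mu> * (L + K)) * norm (x - y)" by (simp add: algebra_simps)
      also have "\<dots> \<le> 1/2 * norm (x - y)" by (intro mult_right_mono muK) auto
      finally show ?thesis by (simp add: dist_norm)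
    qed
    have maps: "T ` cball 0 R \<subseteq> cball 0 R"
    proof clarsimp
      fix x :: 'x assume x: "norm x \<le> R"
      have "norm (V (p, \<mu> *\<^sub>R x) - V 0) \<le> L * norm ((p, \<mu> *\<^sub>R x) - 0)"
        by (intro L small x) simp
      also have "\<dots> \<le> L * (norm p + norm (\<mu> *\<^sub>R x))"
        using L(1) norm_Pair_le[of p "\<mu> *\<^sub>R x"] by (intro mult_left_mono) auto
      also have "\<dots> \<le> L * (\<bar>B\<bar> + \<mu> * R)"
        using p x mu by (intro mult_left_mono add_mono L) (auto simp: mult_left_mono)
      finally have "norm (V (p, \<mu> *\<^sub>R x)) \<le> norm (V 0) + L * (\<bar>B\<bar> + \<mu> * R)"
        using norm_triangle_sub[of "V (p, \<mu> *\<^sub>R x)" "V 0"] by linarith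
      moreover have "norm (\<mu> *\<^sub>R W x) \<le> \<mu> * M" using mu M(2)[OF x] by (simp add: mult_left_mono)
      ultimately have "norm (T x) \<le> norm (V 0) + L * (\<bar>B\<bar> + \<mu> * R) + \<mu> * M"
        unfolding T_def using norm_triangle_ineq[of "V (p, \<mu> *\<^sub>R x)" "\<mu> *\<^sub>R W x"] by linarith
      also have "\<dots> = norm (V 0) + L * \<bar>B\<bar> + \<mu> * (L * R + M)" by (simp add: algebra_simps)
      also have "\<dots> \<le> R" using muL R_def by linarith
      finally show "norm (T x) \<le> R" .
    qed
    have "\<exists>!x\<in>cball 0 R. T x = x"
      by (rule Banach_fix[of _ "1/2"])
        (use maps lip R in \<open>auto intro!: complete_eq_closed[THEN iffD2]\<close>)
    then show ?thesis unfolding T_def by auto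
  qed
  moreover have "1 / A > 0" using A by simp
  ultimately show ?thesis using R that by blast
qed

section \<open>Exponentially decaying sequences and Green operators\<close>

lemma summable_on_geometric_int:
  fixes r :: real
  assumes "0 \<le> r" "r < 1"
  shows "(\<lambda>n::int. r ^ nat \<bar>n\<bar>) summable_on UNIV"
proof -
  have s: "(\<lambda>n. r ^ n) summable_on (UNIV :: nat set)"
    using assms by (intro summable_nonneg_imp_summable_on summable_geometric) auto
  have i: "inj int" "inj (\<lambda>n::nat. - int n)"
    by (auto simp: inj_def)
  have 1: "(\<lambda>n::int. r ^ nat \<bar>n\<bar>) summable_on range int"
    using s by (subst summable_on_reindex[OF i(1)]) (simp add: o_def)
  have 2: "(\<lambda>n::int. r ^ nat \<bar>n\<bar>) summable_on range (\<lambda>n::nat. - int n)"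
    using s by (subst summable_on_reindex[OF i(2)]) (simp add: o_def)
  have "(\<lambda>n::int. r ^ nat \<bar>n\<bar>) summable_on range (\<lambda>n::nat. - int n) - {0}"
    by (rule summable_on_cofin_subset[OF 2]) simp
  moreover have "range int \<inter> (range (\<lambda>n::nat. - int n) - {0}) = {}" by auto
  moreover have "range int \<union> (range (\<lambda>n::nat. - int n) - {0}) = UNIV"
  proof -
    have "n \<in> range int \<union> (range (\<lambda>n::nat. - int n) - {0})" for n :: int
      by (cases n rule: int_cases2) (auto simp: image_iff)
    then show ?thesis by blast
  qed
  ultimately show ?thesis
    using summable_on_Un_disjoint[OF 1] by metis
qed

lemma summable_on_of_geometric_bound:
  fixes x :: "int \<Rightarrow> real"
  assumes "0 \<le> r" "r < 1" "\<And>n. \<bar>x n\<bar> \<le> C * r ^ nat \<bar>n\<bar>"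
  shows "x summable_on UNIV"
proof (rule abs_summable_summable[OF Infinite_Sum.abs_summable_on_comparison_test'])
  show "(\<lambda>n. C * r ^ nat \<bar>n\<bar>) summable_on UNIV"
    by (intro summable_on_cmult_right summable_on_geometric_int assms)
qed (use assms in auto)

lemma infsum_delta:
  fixes x :: "'a \<Rightarrow> real"
  shows "(\<Sum>\<^sub>\<infinity>m. (if m = n then 1 else 0) * x m) = x n"
proof -
  have "(\<Sum>\<^sub>\<infinity>m. (if m = n then 1 else 0) * x m) = (\<Sum>\<^sub>\<infinity>m\<in>{n}. x m)"
    by (rule infsum_cong_neutral) auto
  then show ?thesis by simp
qed

text \<open>Two rates are used: \<open>\<rho>\<close> for kernels and modes, \<open>\<sigma>\<close>
  for the sequences on which they act. The strict gap makes the kernel sums converge like powers of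
  \<open>\<rho> / \<sigma>\<close> while the rate \<open>\<sigma>\<close> is kept.\<close>

locale decay =
  fixes \<rho> \<sigma> :: real
  assumes rho_pos: "0 < \<rho>" and rho_less: "\<rho> < \<sigma>" and sigma_less: "\<sigma> < 1"
begin

text \<open>The weight \<open>\<sigma>\<^bsup>|n|\<^esup>\<close> identifies bounded sequences with sequences of exponential decay.\<close>

definition sq :: "(int discrete \<Rightarrow>\<^sub>C real) \<Rightarrow> int \<Rightarrow> real" where
  "sq x n = \<sigma> ^ nat \<bar>n\<bar> * apply_bcontfun x (discrete n)"

lemma sigma_pos: "0 < \<sigma>"
  using rho_pos rho_less by linarith

lemma sq_add: "sq (x + y) n = sq x n + sq y n"
  and sq_diff: "sq (x - y) n = sq x n - sq y n"
  and sq_scaleR: "sq (a *\<^sub>R x) n = a * sq x n"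
  by (simp_all add: sq_def algebra_simps)

lemma sq_bound: "\<bar>sq x n\<bar> \<le> norm x * \<sigma> ^ nat \<bar>n\<bar>"
  using norm_bounded[of x "discrete n"] sigma_pos by (simp add: sq_def abs_mult mult.commute)

lemma sq_inject:
  assumes "\<And>n. sq x n = sq y n"
  shows "x = y"
proof (rule bcontfun_eqI)
  show "apply_bcontfun x n = apply_bcontfun y n" for n
    using assms[of "of_discrete n"] sigma_pos by (simp add: sq_def of_discrete_inverse)
qed

lemma sq_exists:
  assumes "\<And>n. \<bar>h n\<bar> \<le> C * \<sigma> ^ nat \<bar>n\<bar>"
  obtains x where "sq x = h" "norm x \<le> C"
proof -
  let ?g = "\<lambda>n. h (of_discrete n) / \<sigma> ^ nat \<bar>of_discrete n\<bar>"
  have b: "norm (?g n) \<le> C" for n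
    using assms[of "of_discrete n"] sigma_pos by (simp add: field_simps)
  have "continuous_on UNIV ?g"
    by (auto simp: continuous_on_open_vimage open_discrete)
  then have g: "?g \<in> bcontfun"
    using b by (rule bcontfun_normI)
  have e: "apply_bcontfun (Bcontfun ?g) = ?g"
    using g by (rule Bcontfun_inverse)
  have "sq (Bcontfun ?g) = h"
    using sigma_pos by (auto simp: sq_def e discrete_inverse)
  moreover have "norm (Bcontfun ?g) \<le> C"
    using b by (intro norm_bound) (simp add: e)
  ultimately show ?thesis using that by blast
qed

text \<open>By the triangle inequality, moving the weight from site \<open>m\<close> to site
  \<open>n\<close> costs a factor \<open>1 / \<sigma>\<close> per unit of distance; the kernel pays
  for it and keeps \<open>\<rho> / \<sigma>\<close>.\<close>

lemma kernel_term_bound: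
  assumes "\<bar>k\<bar> \<le> C * \<rho> ^ nat \<bar>n - m\<bar>"
  shows "\<bar>k * sq x m\<bar> \<le> (C * norm x * \<sigma> ^ nat \<bar>n\<bar>) * (\<rho> / \<sigma>) ^ nat \<bar>m - n\<bar>"
proof -
  have C: "0 \<le> C * \<rho> ^ nat \<bar>n - m\<bar>" using assms by linarith
  have "nat \<bar>n\<bar> \<le> nat \<bar>m\<bar> + nat \<bar>n - m\<bar>" by linarith
  then have "\<sigma> ^ nat \<bar>m\<bar> * \<sigma> ^ nat \<bar>n - m\<bar> \<le> \<sigma> ^ nat \<bar>n\<bar>"
    using sigma_pos sigma_less by (simp add: power_decreasing flip: power_add)
  then have s: "\<sigma> ^ nat \<bar>m\<bar> \<le> \<sigma> ^ nat \<bar>n\<bar> / \<sigma> ^ nat \<bar>n - m\<bar>"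
    using sigma_pos by (simp add: field_simps)
  have "\<bar>k * sq x m\<bar> \<le> (C * \<rho> ^ nat \<bar>n - m\<bar>) * (norm x * \<sigma> ^ nat \<bar>m\<bar>)"
    unfolding abs_mult by (intro mult_mono assms sq_bound C) auto
  also have "\<dots> \<le> (C * \<rho> ^ nat \<bar>n - m\<bar>) * (norm x * (\<sigma> ^ nat \<bar>n\<bar> / \<sigma> ^ nat \<bar>n - m\<bar>))"
    by (intro mult_left_mono s C) auto
  also have "\<dots> = (C * norm x * \<sigma> ^ nat \<bar>n\<bar>) * (\<rho> / \<sigma>) ^ nat \<bar>m - n\<bar>"
    by (simp add: power_divide abs_minus_commute)
  finally show ?thesis .
qed

lemma summable_ratio: "(\<lambda>m. c * (\<rho> / \<sigma>) ^ nat \<bar>m - n\<bar>) summable_on (UNIV :: int set)"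
  and infsum_ratio: "(\<Sum>\<^sub>\<infinity>m. c * (\<rho> / \<sigma>) ^ nat \<bar>m - n\<bar>) = c * (\<Sum>\<^sub>\<infinity>m::int. (\<rho> / \<sigma>) ^ nat \<bar>m\<bar>)"
proof -
  have b: "bij_betw (\<lambda>m::int. m - n) UNIV UNIV"
    by (rule bij_betwI[of _ _ _ "\<lambda>m. m + n"]) auto
  have "(\<lambda>m::int. (\<rho> / \<sigma>) ^ nat \<bar>m\<bar>) summable_on UNIV"
    using rho_pos rho_less by (intro summable_on_geometric_int) (auto simp: field_simps)
  then show "(\<lambda>m. c * (\<rho> / \<sigma>) ^ nat \<bar>m - n\<bar>) summable_on (UNIV :: int set)"
    using summable_on_reindex_bij_betw[OF b, of "\<lambda>m. (\<rho> / \<sigma>) ^ nat \<bar>m\<bar>"]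
    by (intro summable_on_cmult_right) simp
  show "(\<Sum>\<^sub>\<infinity>m. c * (\<rho> / \<sigma>) ^ nat \<bar>m - n\<bar>) = c * (\<Sum>\<^sub>\<infinity>m::int. (\<rho> / \<sigma>) ^ nat \<bar>m\<bar>)"
    using infsum_reindex_bij_betw[OF b, of "\<lambda>m. (\<rho> / \<sigma>) ^ nat \<bar>m\<bar>"]
    by (simp add: infsum_cmult_right')
qed

lemma kernel_summable:
  assumes "\<And>n m. \<bar>K n m\<bar> \<le> C * \<rho> ^ nat \<bar>n - m\<bar>"
  shows "(\<lambda>m. K n m * sq x m) summable_on UNIV"
proof (rule abs_summable_summable[OF Infinite_Sum.abs_summable_on_comparison_test'[OF summable_ratio]])
  show "norm (K n m * sq x m) \<le> (C * norm x * \<sigma> ^ nat \<bar>n\<bar>) * (\<rho> / \<sigma>) ^ nat \<bar>m - n\<bar>" for m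
    using kernel_term_bound[OF assms] by simp
qed

lemma kernel_operator:
  assumes K: "\<And>n m. \<bar>K n m\<bar> \<le> C * \<rho> ^ nat \<bar>n - m\<bar>"
  obtains T where "bounded_linear T" "\<And>x n. sq (T x) n = (\<Sum>\<^sub>\<infinity>m. K n m * sq x m)"
proof -
  define A where "A = (\<Sum>\<^sub>\<infinity>m::int. (\<rho> / \<sigma>) ^ nat \<bar>m\<bar>)"
  have "\<exists>y. sq y = (\<lambda>n. \<Sum>\<^sub>\<infinity>m. K n m * sq x m) \<and> norm y \<le> norm x * (C * A)" for x
  proof -
    have "\<bar>\<Sum>\<^sub>\<infinity>m. K n m * sq x m\<bar> \<le> (norm x * (C * A)) * \<sigma> ^ nat \<bar>n\<bar>" for n
    proof -
      have "norm (\<Sum>\<^sub>\<infinity>m. K n m * sq x m) \<le> (C * norm x * \<sigma> ^ nat \<bar>n\<bar>) * A"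
        unfolding A_def infsum_ratio[symmetric, of _ n]
        by (rule norm_infsum_le[OF has_sum_infsum[OF kernel_summable[OF K]] has_sum_infsum[OF summable_ratio]])
          (use kernel_term_bound[OF K] in auto)
      then show ?thesis by (simp add: algebra_simps)
    qed
    then obtain y where "sq y = (\<lambda>n. \<Sum>\<^sub>\<infinity>m. K n m * sq x m)" "norm y \<le> norm x * (C * A)"
      by (rule sq_exists)
    then show ?thesis by blast
  qed
  then obtain T where "\<forall>x. sq (T x) = (\<lambda>n. \<Sum>\<^sub>\<infinity>m. K n m * sq x m) \<and> norm (T x) \<le> norm x * (C * A)"
    using choice[of "\<lambda>x y. sq y = (\<lambda>n. \<Sum>\<^sub>\<infinity>m. K n m * sq x m) \<and> norm y \<le> norm x * (C * A)"] by blast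
  then have T: "\<And>x. sq (T x) = (\<lambda>n. \<Sum>\<^sub>\<infinity>m. K n m * sq x m)"
    "\<And>x. norm (T x) \<le> norm x * (C * A)" by blast+
  have "bounded_linear T"
  proof (rule bounded_linear_intro[of _ "C * A"])
    show "T (x + y) = T x + T y" for x y
      by (rule sq_inject)
        (simp add: T sq_add distrib_left infsum_add kernel_summable[OF K])
    show "T (r *\<^sub>R x) = r *\<^sub>R T x" for r x
      by (rule sq_inject) (simp add: T sq_scaleR mult.left_commute infsum_cmult_right')
    show "norm (T x) \<le> norm x * (C * A)" for x by (rule T)
  qed
  then show ?thesis using that T(1) by simp
qed

text \<open>A first-order difference of the output acts on the first index of the kernel alone, so
  that inverting a difference operator becomes a pointwise identity for kernels.\<close>

lemma kernel_first_order:
  assumes K: "\<And>n m. \<bar>K n m\<bar> \<le> C * \<rho> ^ nat \<bar>n - m\<bar>"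
  shows "(\<Sum>\<^sub>\<infinity>m. K n m * sq x m) - a * (\<Sum>\<^sub>\<infinity>m. K n' m * sq x m)
       = (\<Sum>\<^sub>\<infinity>m. (K n m - a * K n' m) * sq x m)"
proof -
  have "(\<lambda>m. (K n m - a * K n' m) * sq x m) = (\<lambda>m. K n m * sq x m + (- a) * (K n' m * sq x m))"
    by (auto simp: algebra_simps)
  then show ?thesis
    by (simp only: infsum_add[OF kernel_summable[OF K] summable_on_cmult_right[OF kernel_summable[OF K]]]
        infsum_cmult_right')
qed

lemma shift_operator:
  fixes a :: "int \<Rightarrow> real"
  assumes "\<And>n. \<bar>a n\<bar> \<le> C"
  obtains T where "bounded_linear T" "\<And>x n. sq (T x) n = a n * sq x (n + j)"
proof -
  let ?K = "\<lambda>n m. a n * (if m = n + j then 1 else 0)"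
  have "\<bar>?K n m\<bar> \<le> C / \<rho> ^ nat \<bar>j\<bar> * \<rho> ^ nat \<bar>n - m\<bar>" for n m
  proof (cases "m = n + j")
    case True
    then show ?thesis using assms[of n] rho_pos by simp
  next
    case False
    have "0 \<le> C" using assms[of 0] by linarith
    then show ?thesis using False rho_pos by simp
  qed
  then obtain T where T: "bounded_linear T" "\<And>x n. sq (T x) n = (\<Sum>\<^sub>\<infinity>m. ?K n m * sq x m)"
    using kernel_operator[of ?K] by blast
  have "sq (T x) n = a n * sq x (n + j)" for x n
    unfolding T(2) mult.assoc by (simp only: infsum_cmult_right' infsum_delta)
  then show ?thesis using that T(1) by blast
qed

lemma pairing_functional:
  assumes "\<And>m. \<bar>w m\<bar> \<le> C * \<rho> ^ nat \<bar>m\<bar>"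
  obtains \<phi> where "bounded_linear \<phi>" "\<And>x. \<phi> x = (\<Sum>\<^sub>\<infinity>m. w m * sq x m)"
proof -
  \<comment> \<open>The functional is realised as the entry at site \<open>0\<close> of a kernel
    operator whose only nonzero row is row \<open>0\<close>.\<close>
  let ?K = "\<lambda>n m. if n = 0 then w m else 0"
  have "0 \<le> C" using assms[of 0] by simp
  then have "\<bar>?K n m\<bar> \<le> C * \<rho> ^ nat \<bar>n - m\<bar>" for n m
    using assms[of m] rho_pos by simp
  then obtain T where T: "bounded_linear T" "\<And>x n. sq (T x) n = (\<Sum>\<^sub>\<infinity>m. ?K n m * sq x m)"
    using kernel_operator[of ?K] by blast
  have "bounded_linear (\<lambda>x. sq x 0)"
    by (rule bounded_linear_intro[of _ 1]) (use sq_bound[of _ 0] in \<open>auto simp: sq_add sq_scaleR\<close>)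
  from bounded_linear_compose[OF this T(1)]
  have "bounded_linear (\<lambda>x. sq (T x) 0)" .
  moreover have "sq (T x) 0 = (\<Sum>\<^sub>\<infinity>m. w m * sq x m)" for x by (simp add: T(2))
  ultimately show ?thesis using that by blast
qed

text \<open>The operator \<open>x \<mapsto> x\<^sub>n - (\<omega>\<^sub>n / \<omega>\<^sub>n\<^sub>-\<^sub>1) x\<^sub>n\<^sub>-\<^sub>1\<close> annihilates \<open>\<omega>\<close>. If \<open>\<omega>\<close> decays at both ends, it has
  a right inverse, and its transpose is invertible up to a defect which is placed at the site \<open>0\<close>.\<close>

lemma green_two_sided_decay:
  assumes pos: "\<And>n. \<omega> n > (0::real)"
    and right: "\<And>m n. 0 \<le> m \<Longrightarrow> m \<le> n \<Longrightarrow> \<omega> n \<le> C * \<rho> ^ nat (n - m) * \<omega> m"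
    and left: "\<And>m n. n \<le> m \<Longrightarrow> m \<le> 0 \<Longrightarrow> \<omega> n \<le> C * \<rho> ^ nat (m - n) * \<omega> m"
  obtains G G' where "bounded_linear G" "bounded_linear G'"
    "\<And>h n. sq (G h) n - \<omega> n / \<omega> (n - 1) * sq (G h) (n - 1) = sq h n"
    "\<And>h n. sq (G' h) n - \<omega> (n + 1) / \<omega> n * sq (G' h) (n + 1)
       = sq h n - (if n = 0 then (\<Sum>\<^sub>\<infinity>m. \<omega> m * sq h m) / \<omega> 0 else 0)"
proof -
  \<comment> \<open>Variation of constants for the solution that vanishes at site \<open>0\<close>.
    An entry is nonzero only if \<open>n\<close> lies on the same side as \<open>m\<close> and at
    least as far out, which is where the outward decay bounds control
    \<open>\<omega> n / \<omega> m\<close>.\<close>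
  define s :: "int \<Rightarrow> int \<Rightarrow> real"
    where "s n m = (if 1 \<le> m \<and> m \<le> n then 1 else if n < m \<and> m \<le> 0 then -1 else 0)" for n m
  define K where "K n m = \<omega> n / \<omega> m * s n m" for n m
  have C: "0 \<le> C" using right[of 0 0] pos[of 0] by (simp add: mult_le_cancel_right1)
  have K: "\<bar>K n m\<bar> \<le> C * \<rho> ^ nat \<bar>n - m\<bar>" for n m
  proof -
    consider "1 \<le> m \<and> m \<le> n" | "n < m \<and> m \<le> 0" | "\<not> (1 \<le> m \<and> m \<le> n)" "\<not> (n < m \<and> m \<le> 0)" by blast
    then show ?thesis
    proof cases
      case 1
      then show ?thesis using right[of m n] pos[of m] pos[of n] by (simp add: K_def s_def abs_mult field_simps)
    next
      case 2
      then show ?thesis using left[of n m] pos[of m] pos[of n] by (simp add: K_def s_def abs_mult field_simps)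
    next
      case 3
      then have "K n m = 0" by (auto simp: K_def s_def)
      then show ?thesis using C rho_pos by simp
    qed
  qed
  obtain G where G: "bounded_linear G" "\<And>x n. sq (G x) n = (\<Sum>\<^sub>\<infinity>m. K n m * sq x m)"
    using kernel_operator[of K, OF K] by blast
  have K': "\<bar>K m n\<bar> \<le> C * \<rho> ^ nat \<bar>n - m\<bar>" for n m
    using K[of m n] by (simp add: abs_minus_commute)
  obtain G' where G': "bounded_linear G'" "\<And>x n. sq (G' x) n = (\<Sum>\<^sub>\<infinity>m. K m n * sq x m)"
    using kernel_operator[of "\<lambda>n m. K m n", OF K'] by blast
  have k: "K n m - \<omega> n / \<omega> (n - 1) * K (n - 1) m = (if m = n then 1 else 0)" for n m
  proof -
    have "K n m - \<omega> n / \<omega> (n - 1) * K (n - 1) m = \<omega> n / \<omega> m * (s n m - s (n - 1) m)"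
      using pos[of "n-1"] by (simp add: K_def right_diff_distrib)
    also have "s n m - s (n - 1) m = (if m = n then 1 else 0)" by (auto simp: s_def)
    finally show ?thesis using pos[of n] by simp
  qed
  have "sq (G h) n - \<omega> n / \<omega> (n - 1) * sq (G h) (n - 1) = sq h n" for h n
    unfolding G(2) kernel_first_order[of K, OF K] k by (rule infsum_delta)
  moreover have "sq (G' h) n - \<omega> (n + 1) / \<omega> n * sq (G' h) (n + 1)
       = sq h n - (if n = 0 then (\<Sum>\<^sub>\<infinity>m. \<omega> m * sq h m) / \<omega> 0 else 0)" for h n
  proof -
    \<comment> \<open>Transposed, the sign function jumps at \<open>n = m\<close> and once more at
      \<open>n = 0\<close>, whatever \<open>m\<close> is. The second jump collects all of
      \<open>h\<close> against \<open>\<omega>\<close> and is the defect.\<close>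
    have k': "K m n - \<omega> (n + 1) / \<omega> n * K m (n + 1)
      = (if m = n then 1 else 0) - (if n = 0 then \<omega> m / \<omega> 0 else 0)" for m
    proof -
      have "K m n - \<omega> (n + 1) / \<omega> n * K m (n + 1) = \<omega> m / \<omega> n * (s m n - s m (n + 1))"
        using pos[of "n+1"] by (simp add: K_def right_diff_distrib)
      also have "s m n - s m (n + 1) = (if m = n then 1 else 0) - (if n = 0 then 1 else 0)"
        by (auto simp: s_def)
      finally show ?thesis using pos[of n] pos[of 0] by auto
    qed
    have summ: "(\<lambda>m. \<omega> m * sq h m) summable_on UNIV"
    proof (rule kernel_summable[where K="\<lambda>n m. if n = 0 then \<omega> m else 0" and n=0, simplified])
      show "\<bar>if n = 0 then \<omega> m else 0\<bar> \<le> C * \<omega> 0 * \<rho> ^ nat \<bar>n - m\<bar>" for n m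
      proof (cases "n = 0")
        case True
        then show ?thesis
          using right[of 0 m] left[of m 0] pos[of m] by (cases "m \<ge> 0") (simp_all add: mult_ac)
      next
        case False
        then show ?thesis using C pos[of 0] rho_pos by simp
      qed
    qed
    have "(\<Sum>\<^sub>\<infinity>m. ((if m = n then 1 else 0) - (if n = 0 then \<omega> m / \<omega> 0 else 0)) * sq h m)
      = sq h n - (if n = 0 then (\<Sum>\<^sub>\<infinity>m. \<omega> m * sq h m) / \<omega> 0 else 0)"
    proof (cases "n = 0")
      case True
      have d: "(\<lambda>m. (if m = n then 1 else 0) * sq h m) summable_on UNIV"
        by (rule summable_on_cong_neutral[THEN iffD1, of _ "{n}"]) auto
      have "(\<Sum>\<^sub>\<infinity>m. ((if m = n then 1 else 0) - (if n = 0 then \<omega> m / \<omega> 0 else 0)) * sq h m)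
         = (\<Sum>\<^sub>\<infinity>m. (if m = n then 1 else 0) * sq h m + (- (1 / \<omega> 0)) * (\<omega> m * sq h m))"
        using True by (intro infsum_cong) (simp add: left_diff_distrib)
      also have "\<dots> = sq h n + (- (1 / \<omega> 0)) * (\<Sum>\<^sub>\<infinity>m. \<omega> m * sq h m)"
        by (simp only: infsum_add[OF d summable_on_cmult_right[OF summ]] infsum_delta infsum_cmult_right')
      finally show ?thesis using True by simp
    next
      case False
      then show ?thesis by (simp only: if_False diff_0_right infsum_delta)
    qed
    then show ?thesis
      unfolding G'(2) kernel_first_order[of "\<lambda>n m. K m n", OF K'] k' .
  qed
  ultimately show ?thesis using that G(1) G'(1) by blast
qed

text \<open>Summing from \<open>+\<infinity>\<close> uses only entries with \<open>n < m\<close>,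
  where \<open>\<omega> n / \<omega> m\<close> is small; hence the operator and its transpose are
  both solved without a defect. The sign of \<open>\<omega>\<close> is left free because the weight
  of interest alternates.\<close>

lemma green_growing:
  assumes nz: "\<And>n. \<omega> n \<noteq> (0::real)"
    and grow: "\<And>m n. n \<le> m \<Longrightarrow> \<bar>\<omega> n\<bar> \<le> C * \<rho> ^ nat (m - n) * \<bar>\<omega> m\<bar>"
  obtains G G' where "bounded_linear G" "bounded_linear G'"
    "\<And>h n. sq (G h) n - \<omega> n / \<omega> (n - 1) * sq (G h) (n - 1) = sq h n"
    "\<And>h n. sq (G' h) n - \<omega> (n + 1) / \<omega> n * sq (G' h) (n + 1) = sq h n"
proof -
  let ?K = "\<lambda>n m. \<omega> n / \<omega> m * (if n < m then -1 else 0)"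
  have C: "0 \<le> C" using grow[of 0 0] nz[of 0] by (simp add: mult_le_cancel_right1)
  have K: "\<bar>?K n m\<bar> \<le> C * \<rho> ^ nat \<bar>n - m\<bar>" for n m
    using grow[of n m] nz[of m] C rho_pos by (auto simp: abs_mult field_simps)
  obtain G where G: "bounded_linear G" "\<And>x n. sq (G x) n = (\<Sum>\<^sub>\<infinity>m. ?K n m * sq x m)"
    using kernel_operator[of ?K, OF K] by blast
  have K': "\<bar>?K m n\<bar> \<le> C * \<rho> ^ nat \<bar>n - m\<bar>" for n m
    using K[of m n] by (simp add: abs_minus_commute)
  obtain G' where G': "bounded_linear G'" "\<And>x n. sq (G' x) n = (\<Sum>\<^sub>\<infinity>m. ?K m n * sq x m)"
    using kernel_operator[of "\<lambda>n m. ?K m n", OF K'] by blast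
  have k: "?K n m - \<omega> n / \<omega> (n - 1) * ?K (n - 1) m = (if m = n then 1 else 0)"
    and k': "?K m n - \<omega> (n + 1) / \<omega> n * ?K m (n + 1) = (if m = n then 1 else 0)" for n m
    using nz by (cases "m = n"; auto)+
  have "sq (G h) n - \<omega> n / \<omega> (n - 1) * sq (G h) (n - 1) = sq h n" for h n
    unfolding G(2) kernel_first_order[of ?K, OF K] k by (rule infsum_delta)
  moreover have "sq (G' h) n - \<omega> (n + 1) / \<omega> n * sq (G' h) (n + 1) = sq h n" for h n
    unfolding G'(2) kernel_first_order[of "\<lambda>n m. ?K m n", OF K'] k' by (rule infsum_delta)
  ultimately show ?thesis using that G(1) G'(1) by blast
qed

end

section \<open>Geometric weights\<close>

text \<open>The lower bound is kept because ratios of values at two sites, and quotients of two such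
  sequences, have to be estimated.\<close>

definition geometric :: "real \<Rightarrow> (nat \<Rightarrow> real) \<Rightarrow> bool" where
  "geometric x u \<longleftrightarrow> (\<exists>C1>0. \<exists>C2>0. \<forall>k. C1 * x ^ k \<le> u k \<and> u k \<le> C2 * x ^ k)"

lemma geometric_eventuallyI:
  assumes x: "0 < x" and u: "\<And>k. 0 < u k" and C1: "C1 > 0"
    and ev: "\<And>k. k \<ge> K \<Longrightarrow> C1 * x ^ k \<le> u k \<and> u k \<le> C2 * x ^ k"
  shows "geometric x u"
proof -
  let ?S = "(\<lambda>k. u k / x ^ k) ` {..K}"
  have fin: "finite ?S" "?S \<noteq> {}" by auto
  have pos: "Min ?S > 0" using fin x u by (auto simp: Min_gr_iff)
  have "min C1 (Min ?S) * x ^ k \<le> u k \<and> u k \<le> max (max C2 1) (Max ?S) * x ^ k" for k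
  proof (cases "k \<ge> K")
    case True
    have "min C1 (Min ?S) * x ^ k \<le> C1 * x ^ k" "C2 * x ^ k \<le> max (max C2 1) (Max ?S) * x ^ k"
      using x by (auto intro!: mult_right_mono)
    then show ?thesis using ev[OF True] by linarith
  next
    case False
    then have "u k / x ^ k \<in> ?S" by auto
    then have "Min ?S \<le> u k / x ^ k" "u k / x ^ k \<le> Max ?S" using fin by auto
    then have "min C1 (Min ?S) \<le> u k / x ^ k" "u k / x ^ k \<le> max (max C2 1) (Max ?S)" by linarith+
    then show ?thesis using x by (simp add: pos_le_divide_eq pos_divide_le_eq)
  qed
  moreover have "min C1 (Min ?S) > 0" "max (max C2 1) (Max ?S) > 0" using C1 pos by linarith+
  ultimately show ?thesis unfolding geometric_def by blast
qed

lemma geometric_of_ratio: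
  assumes x: "0 < x" and u: "\<And>k. 0 < u k" and r: "\<And>k. k \<ge> K \<Longrightarrow> u (Suc k) = x * u k"
  shows "geometric x u"
proof (rule geometric_eventuallyI[OF x u])
  have e: "u (K + j) = u K / x ^ K * x ^ (K + j)" for j
  proof (induction j)
    case (Suc j)
    then show ?case using r[of "K + j"] by simp
  qed (use x in simp)
  show "u K / x ^ K > 0" using x u by simp
  show "u K / x ^ K * x ^ k \<le> u k \<and> u k \<le> u K / x ^ K * x ^ k" if "k \<ge> K" for k
    using e[of "k - K"] that by simp
qed

lemma geometric_divide:
  assumes "geometric x u" "geometric y v" "0 < x" "0 < y"
  shows "geometric (x / y) (\<lambda>k. u k / v k)"
proof -
  obtain A B where u: "A > 0" "B > 0" "\<And>k. A * x ^ k \<le> u k" "\<And>k. u k \<le> B * x ^ k"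
    using assms(1) unfolding geometric_def by blast
  obtain C D where v: "C > 0" "D > 0" "\<And>k. C * y ^ k \<le> v k" "\<And>k. v k \<le> D * y ^ k"
    using assms(2) unfolding geometric_def by blast
  have "A / D * (x / y) ^ k \<le> u k / v k \<and> u k / v k \<le> B / C * (x / y) ^ k" for k
  proof -
    have xk: "x ^ k > 0" and yk: "y ^ k > 0" using assms by auto
    have vk: "v k > 0" using v(3)[of k] v(1) yk by (smt (verit) mult_pos_pos)
    have "(A * x ^ k) / (D * y ^ k) \<le> u k / v k"
      using u v xk yk vk by (intro frac_le) (auto intro: order_trans[OF _ u(3)])
    moreover have "u k / v k \<le> (B * x ^ k) / (C * y ^ k)"
      using u v xk yk vk by (intro frac_le) auto
    ultimately show ?thesis by (simp add: power_divide)
  qed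
  then show ?thesis unfolding geometric_def using u v by (meson divide_pos_pos)
qed

lemma geometric_Suc:
  assumes "geometric x u" "0 < x"
  shows "geometric x (\<lambda>k. u (Suc k))"
proof -
  obtain A B where u: "A > 0" "B > 0" "\<And>k. A * x ^ k \<le> u k" "\<And>k. u k \<le> B * x ^ k"
    using assms(1) unfolding geometric_def by blast
  have "(A * x) * x ^ k \<le> u (Suc k) \<and> u (Suc k) \<le> (B * x) * x ^ k" for k
    using u(3)[of "Suc k"] u(4)[of "Suc k"] by (simp add: mult_ac)
  then show ?thesis unfolding geometric_def using u assms by (meson mult_pos_pos)
qed

lemma geometric_of_Suc:
  assumes "geometric x (\<lambda>k. u (Suc k))" "0 < x" "u 0 > 0"
  shows "geometric x u"
proof -
  obtain A B where u: "A > 0" "B > 0" "\<And>k. A * x ^ k \<le> u (Suc k)" "\<And>k. u (Suc k) \<le> B * x ^ k"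
    using assms(1) unfolding geometric_def by blast
  show ?thesis
  proof (rule geometric_eventuallyI[where ?C1.0="A / x" and ?C2.0="B / x" and K=1])
    show "0 < u k" for k
      using u(1) u(3)[of "k - 1"] assms(2,3)
      by (cases k) (auto intro: less_le_trans[OF mult_pos_pos[OF u(1) zero_less_power]])
    show "A / x * x ^ k \<le> u k \<and> u k \<le> B / x * x ^ k" if "k \<ge> 1" for k
      using that u(3)[of "k - 1"] u(4)[of "k - 1"] assms(2) by (cases k) auto
  qed (use u assms in auto)
qed

lemma geometric_decay:
  assumes "geometric x u" "0 < x" "x \<le> \<rho>"
  obtains C where "C > 0" "\<And>m n. m \<le> n \<Longrightarrow> u n \<le> C * \<rho> ^ (n - m) * u m"
proof -
  obtain A B where u: "A > 0" "B > 0" "\<And>k. A * x ^ k \<le> u k" "\<And>k. u k \<le> B * x ^ k"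
    using assms(1) unfolding geometric_def by blast
  have "u n \<le> B / A * \<rho> ^ (n - m) * u m" if "m \<le> n" for m n
  proof -
    have "u n \<le> B * x ^ n" by (rule u)
    also have "\<dots> = B / A * x ^ (n - m) * (A * x ^ m)"
      using that u(1) by (simp flip: power_add)
    also have "\<dots> \<le> B / A * \<rho> ^ (n - m) * u m"
      using u assms by (intro mult_mono power_mono) auto
    finally show ?thesis .
  qed
  then show ?thesis using that[of "B / A"] u by simp
qed

text \<open>Decay is phrased for ratios of two sites on the same side of \<open>0\<close>: these are
  the entries of the Green kernel that sums outward from \<open>0\<close>. The growing weight below
  compares arbitrary sites, since its kernel sums from one end.\<close>

definition decay_weight :: "real \<Rightarrow> (int \<Rightarrow> real) \<Rightarrow> bool" where
  "decay_weight \<rho> \<omega> \<longleftrightarrow> (\<forall>n. \<omega> n > 0) \<and>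
     (\<exists>C. (\<forall>m n. 0 \<le> m \<longrightarrow> m \<le> n \<longrightarrow> \<omega> n \<le> C * \<rho> ^ nat (n - m) * \<omega> m) \<and>
          (\<forall>m n. n \<le> m \<longrightarrow> m \<le> 0 \<longrightarrow> \<omega> n \<le> C * \<rho> ^ nat (m - n) * \<omega> m))"

definition growth_weight :: "real \<Rightarrow> (int \<Rightarrow> real) \<Rightarrow> bool" where
  "growth_weight \<rho> \<omega> \<longleftrightarrow> (\<forall>n. \<omega> n > 0) \<and>
     (\<exists>C. \<forall>m n. n \<le> m \<longrightarrow> \<omega> n \<le> C * \<rho> ^ nat (m - n) * \<omega> m)"

lemma decay_weight_geometric:
  assumes pos: "\<And>n. \<omega> n > 0" and r: "0 < \<rho>"
    and "geometric x (\<lambda>k. \<omega> (int k))" "0 < x" "x \<le> \<rho>"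
    and "geometric y (\<lambda>k. \<omega> (- int k))" "0 < y" "y \<le> \<rho>"
  shows "decay_weight \<rho> \<omega>"
proof -
  obtain C where C: "C > 0" "\<And>m n. m \<le> n \<Longrightarrow> \<omega> (int n) \<le> C * \<rho> ^ (n - m) * \<omega> (int m)"
    using geometric_decay[OF assms(3-5)] by blast
  obtain D where D: "D > 0" "\<And>m n. m \<le> n \<Longrightarrow> \<omega> (- int n) \<le> D * \<rho> ^ (n - m) * \<omega> (- int m)"
    using geometric_decay[OF assms(6-8)] by blast
  have "\<omega> n \<le> max C D * \<rho> ^ nat (n - m) * \<omega> m" if "0 \<le> m" "m \<le> n" for m n
  proof -
    have "\<omega> n \<le> C * \<rho> ^ nat (n - m) * \<omega> m"
      using C(2)[of "nat m" "nat n"] that by (simp add: nat_diff_distrib)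
    also have "\<dots> \<le> max C D * \<rho> ^ nat (n - m) * \<omega> m"
      using r pos[of m] by (intro mult_right_mono) auto
    finally show ?thesis .
  qed
  moreover have "\<omega> n \<le> max C D * \<rho> ^ nat (m - n) * \<omega> m" if "n \<le> m" "m \<le> 0" for m n
  proof -
    have "nat (m - n) = nat (- n) - nat (- m)" using that by linarith
    then have "\<omega> n \<le> D * \<rho> ^ nat (m - n) * \<omega> m"
      using D(2)[of "nat (- m)" "nat (- n)"] that by simp
    also have "\<dots> \<le> max C D * \<rho> ^ nat (m - n) * \<omega> m"
      using r pos[of m] by (intro mult_right_mono) auto
    finally show ?thesis .
  qed
  ultimately show ?thesis unfolding decay_weight_def using pos by blast
qed

lemma growth_weight_geometric:
  assumes pos: "\<And>n. \<omega> n > 0" and r: "0 < \<rho>"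
    and "geometric x (\<lambda>k. 1 / \<omega> (int k))" "0 < x" "x \<le> \<rho>"
    and "geometric y (\<lambda>k. \<omega> (- int k))" "0 < y" "y \<le> \<rho>"
  shows "growth_weight \<rho> \<omega>"
proof -
  obtain C where C: "C > 0" "\<And>m n. m \<le> n \<Longrightarrow> 1 / \<omega> (int n) \<le> C * \<rho> ^ (n - m) * (1 / \<omega> (int m))"
    using geometric_decay[OF assms(3-5)] by blast
  obtain D where D: "D > 0" "\<And>m n. m \<le> n \<Longrightarrow> \<omega> (- int n) \<le> D * \<rho> ^ (n - m) * \<omega> (- int m)"
    using geometric_decay[OF assms(6-8)] by blast
  have R: "\<omega> n \<le> C * \<rho> ^ nat (m - n) * \<omega> m" if "0 \<le> n" "n \<le> m" for m n
  proof -
    have "1 / \<omega> m \<le> C * \<rho> ^ nat (m - n) * (1 / \<omega> n)"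
      using C(2)[of "nat n" "nat m"] that by (simp add: nat_diff_distrib)
    then show ?thesis using pos[of n] pos[of m] by (simp add: field_simps)
  qed
  have L: "\<omega> n \<le> D * \<rho> ^ nat (m - n) * \<omega> m" if "n \<le> m" "m \<le> 0" for m n
  proof -
    have "nat (m - n) = nat (- n) - nat (- m)" using that by linarith
    then show ?thesis using D(2)[of "nat (- m)" "nat (- n)"] that by simp
  qed
  let ?E = "max (max C D) (D * C)"
  have le: "c * \<rho> ^ k * \<omega> m \<le> ?E * \<rho> ^ k * \<omega> m" if "c \<le> ?E" for c k m
    using r pos[of m] that by (intro mult_right_mono) auto
  have "\<omega> n \<le> ?E * \<rho> ^ nat (m - n) * \<omega> m" if "n \<le> m" for m n
  proof -
    consider "0 \<le> n" | "m \<le> 0" | "n \<le> 0" "0 \<le> m" by linarith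
    then show ?thesis
    proof cases
      case 1
      then show ?thesis by (intro order_trans[OF R le] that) auto
    next
      case 2
      then show ?thesis by (intro order_trans[OF L le] that) auto
    next
      case 3
      \<comment> \<open>Sites on opposite sides are compared through site \<open>0\<close>, at the
        cost of the product of the two constants.\<close>
      have "\<omega> n \<le> D * \<rho> ^ nat (0 - n) * \<omega> 0" by (rule L) (use 3 in auto)
      also have "\<dots> \<le> D * \<rho> ^ nat (0 - n) * (C * \<rho> ^ nat (m - 0) * \<omega> m)"
        using D(1) r 3 by (intro mult_left_mono R) auto
      also have "\<dots> = D * C * \<rho> ^ (nat (0 - n) + nat (m - 0)) * \<omega> m"
        by (simp add: power_add)
      also have "nat (0 - n) + nat (m - 0) = nat (m - n)" using 3 by linarith
      also have "D * C * \<rho> ^ nat (m - n) * \<omega> m \<le> ?E * \<rho> ^ nat (m - n) * \<omega> m" by (rule le) simp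
      finally show ?thesis .
    qed
  qed
  then show ?thesis unfolding growth_weight_def using pos by blast
qed

section \<open>Zero modes at the interface\<close>

lemma int_recurrence_exists:
  fixes r :: "int \<Rightarrow> real"
  assumes r: "\<And>n. r n > 0"
  obtains \<omega> where "\<And>n. \<omega> n > 0" "\<And>n. \<omega> (n + 1) = r n * \<omega> n"
proof
  define \<omega> where "\<omega> n = (if n \<ge> 0 then \<Prod>i<nat n. r (int i) else 1 / (\<Prod>i<nat (- n). r (- 1 - int i)))" for n
  show "\<omega> n > 0" for n
    using r by (auto simp: \<omega>_def intro!: prod_pos divide_pos_pos)
  show "\<omega> (n + 1) = r n * \<omega> n" for n
  proof (cases "n \<ge> 0")
    case True
    then have "nat (n + 1) = Suc (nat n)" by linarith
    then show ?thesis using True by (simp add: \<omega>_def mult.commute)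
  next
    case False
    define k where "k = nat (- n - 1)"
    have k: "nat (- n) = Suc k" "n = - 1 - int k" using False by (auto simp: k_def)
    have "\<omega> n = 1 / (\<Prod>i<Suc k. r (- 1 - int i))"
      using False by (simp only: \<omega>_def k(1) if_False)
    moreover have "\<omega> (n + 1) = 1 / (\<Prod>i<k. r (- 1 - int i))"
      by (cases "k = 0") (auto simp: \<omega>_def k(2))
    ultimately show ?thesis
      using r[of n] by (simp add: k(2))
  qed
qed

locale interface =
  fixes bp bm dp dm cc :: real
  assumes bp: "bp > 0" and bm: "bm > 0" and dp: "dp > 0" and dm: "dm < 0"
    and bdm: "bm + dm > 0" and cc: "cc > 0"
begin

definition b :: "int \<Rightarrow> real" where
  "b n = (if n \<ge> 0 then bp else bm)"

definition c :: "int \<Rightarrow> real" where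
  "c n = (if n \<ge> 0 then bp + dp else if n = -1 then cc else bm + dm)"

definition d :: "int \<Rightarrow> real" where
  "d n = (if n \<ge> 0 then bp + dp else if n = -1 \<or> n = -2 then cc else bm + dm)"

lemma b_pos: "b n > 0" and c_pos: "c n > 0" and d_pos: "d n > 0"
  using bp bm dp bdm cc by (auto simp: b_def c_def d_def)

lemma odd_mode:
  obtains \<rho> f where "0 < \<rho>" "\<rho> < 1" "\<And>\<rho>'. \<rho> \<le> \<rho>' \<Longrightarrow> decay_weight \<rho>' f" "\<And>n. c n * f (n + 1) = b n * f n"
proof -
  obtain f where f: "\<And>n. f n > 0" "\<And>n. f (n + 1) = b n / c n * f n"
    using int_recurrence_exists[of "\<lambda>n. b n / c n"] b_pos c_pos by (metis divide_pos_pos)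
  define x where "x = bp / (bp + dp)"
  define y where "y = (bm + dm) / bm"
  have x: "0 < x" "x < 1" and y: "0 < y" "y < 1"
    using bp dp bm dm bdm by (auto simp: x_def y_def)
  have gx: "geometric x (\<lambda>k. f (int k))"
  proof (rule geometric_of_ratio[where K=0])
    show "f (int (Suc k)) = x * f (int k)" for k
      using f(2)[of "int k"] by (simp add: b_def c_def x_def add.commute)
  qed (use x f in auto)
  have gy: "geometric y (\<lambda>k. f (- int k))"
  \<comment> \<open>The constant ratio begins only beyond the interface bond, where \<open>c\<close>
    equals \<open>cc\<close>.\<close>
  proof (rule geometric_of_ratio[where K=1])
    show "f (- int (Suc k)) = y * f (- int k)" if "1 \<le> k" for k
    proof -
      have "f (- int k) = bm / (bm + dm) * f (- int (Suc k))"
        using f(2)[of "- int (Suc k)"] that by (simp add: b_def c_def)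
      then show ?thesis using bm bdm by (simp add: y_def)
    qed
  qed (use y f in auto)
  show ?thesis
  proof (rule that[of "max x y" f])
    show "decay_weight \<rho>' f" if "max x y \<le> \<rho>'" for \<rho>'
      by (rule decay_weight_geometric[OF f(1) _ gx _ _ gy]) (use x y that in auto)
    show "c n * f (n + 1) = b n * f n" for n
      using f(2)[of n] c_pos[of n] by simp
  qed (use x y in auto)
qed

text \<open>At \<open>k = 0\<close> the even part of the kernel equation is a three-term recurrence. Solved towards
  \<open>-\<infinity>\<close> it has positive coefficients, so the solution that decays at \<open>+\<infinity>\<close> is positive.\<close>

fun bwd :: "real \<Rightarrow> nat \<Rightarrow> real" where
  "bwd y 0 = y"
| "bwd y (Suc 0) = 1"
| "bwd y (Suc (Suc k)) =
     (b (1 - int k) * bwd y k + c (- int k) * bwd y (Suc k)) * d (- 1 - int k)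
       / (2 * b (1 - int k) * b (- 1 - int k))"

lemma bwd_pos: "y > 0 \<Longrightarrow> bwd y k > 0"
  by (induction y k rule: bwd.induct) (auto intro!: divide_pos_pos mult_pos_pos add_pos_pos b_pos c_pos d_pos)

declare bwd.simps [simp del]

text \<open>The recurrence of \<open>P\<close> arises by eliminating component 2 from the even
  equations at zero energy. Up to alternating signs, \<open>W\<close> solves the complementary
  first-order factor. In each bulk the characteristic equation has a positive root, the ratio of
  \<open>P\<close>, and a negative one of modulus above \<open>1\<close>, which makes
  \<open>W\<close> grow.\<close>

lemma even_mode:
  obtains \<rho> P W where "0 < \<rho>" "\<rho> < 1"
    "\<And>\<rho>'. \<rho> \<le> \<rho>' \<Longrightarrow> decay_weight \<rho>' P" "\<And>\<rho>'. \<rho> \<le> \<rho>' \<Longrightarrow> growth_weight \<rho>' W"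
    "\<And>n. b n * P n + c (n - 1) * P (n - 1) = 2 * b n * b (n - 2) / d (n - 2) * P (n - 2)"
    "\<And>n. W n / W (n - 1) = 2 * b (n - 2) / d (n - 2) * P (n - 2) / P (n - 1)"
proof -
  define r where "r = (bp + dp) / bp"
  define r' where "r' = (bm + dm) / bm"
  have r: "1 < r" and r': "0 < r'" "r' < 1"
    using bp dp bm dm bdm by (auto simp: r_def r'_def field_simps)
  \<comment> \<open>The characteristic equation of the right bulk, divided by \<open>bp\<close>:
    \<open>y\<close> is the factor per site to the right, and \<open>r > 1\<close> puts it below
    \<open>1\<close>.\<close>
  have "\<exists>y\<ge>0. y \<le> 1 \<and> y\<^sup>2 + r * y - 2 / r = 0"
  proof (rule IVT'[of "\<lambda>y. y\<^sup>2 + r * y - 2 / r" 0 0 1])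
    have "2 \<le> (1 + r) * r" using r mult_mono[of 2 "1 + r" 1 r] by simp
    then show "0 \<le> 1\<^sup>2 + r * 1 - 2 / r" using r by (simp add: field_simps)
  qed (use r in \<open>auto intro!: continuous_intros\<close>)
  then obtain y where y: "0 \<le> y" "y \<le> 1" "y\<^sup>2 + r * y = 2 / r" by auto
  have "y \<noteq> 0" using y(3) r by auto
  moreover have "y \<noteq> 1"
  proof
    assume "y = 1"
    then have "(1 + r) * r = 2" using y(3) r by (simp add: field_simps)
    moreover have "(1 + r) * r > 2 * 1" using r by (intro mult_strict_mono) auto
    ultimately show False by simp
  qed
  ultimately have y01: "0 < y" "y < 1" using y by auto
  \<comment> \<open>The left bulk, written for the factor \<open>x\<close> per site to the left,
    which is the reciprocal of the positive root; \<open>r' < 1\<close> puts it below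
    \<open>1\<close>.\<close>
  have "\<exists>x\<ge>0. x \<le> 1 \<and> 2 / r' * x\<^sup>2 - r' * x - 1 = 0"
  proof (rule IVT'[of "\<lambda>x. 2 / r' * x\<^sup>2 - r' * x - 1" 0 0 1])
    have "(1 + r') * r' \<le> 2 * 1" using r' by (intro mult_mono) auto
    then show "0 \<le> 2 / r' * 1\<^sup>2 - r' * 1 - 1" using r' by (simp add: field_simps)
  qed (use r' in \<open>auto intro!: continuous_intros\<close>)
  then obtain x where x: "0 \<le> x" "x \<le> 1" "2 / r' * x\<^sup>2 = 1 + r' * x" by auto
  have "x \<noteq> 0" using x(3) by auto
  moreover have "x \<noteq> 1"
  proof
    assume "x = 1"
    then have "(1 + r') * r' = 2" using x(3) r' by (simp add: field_simps)
    moreover have "(1 + r') * r' < 2 * 1" using r' by (intro mult_strict_mono) auto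
    ultimately show False by simp
  qed
  ultimately have x01: "0 < x" "x < 1" using x by auto

  \<comment> \<open>The pieces overlap: \<open>bwd y\<close> starts with the values \<open>y\<close>
    and \<open>1\<close> of the pure exponential at the sites \<open>1\<close> and \<open>0\<close>
    and is continued to the left from there.\<close>
  define P where "P n = (if n \<ge> 0 then y ^ nat n else bwd y (nat (1 - n)))" for n
  have P_pos: "P n > 0" for n using y01 by (auto simp: P_def bwd_pos)
  have P_back: "P (1 - int k) = bwd y k" for k
  proof -
    consider "k = 0" | "k = 1" | "k \<ge> 2" by linarith
    then show ?thesis by cases (auto simp: P_def bwd.simps)
  qed
  have P_rec: "b n * P n + c (n - 1) * P (n - 1) = 2 * b n * b (n - 2) / d (n - 2) * P (n - 2)" for n
  proof (cases "n \<ge> 2")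
    case True
    define k where "k = nat (n - 2)"
    have n: "n = int k + 2" using True by (simp add: k_def)
    have P: "P n = y ^ (k + 2)" "P (n - 1) = y ^ (k + 1)" "P (n - 2) = y ^ k"
      by (auto simp: P_def n nat_add_distrib simp del: power_Suc)
    have "bp * y\<^sup>2 + (bp + dp) * y = bp * (y\<^sup>2 + r * y)" using bp by (simp add: r_def field_simps)
    also have "\<dots> = 2 * bp * bp / (bp + dp)" unfolding y(3) using bp dp by (simp add: r_def)
    finally have "y ^ k * (bp * y\<^sup>2 + (bp + dp) * y) = y ^ k * (2 * bp * bp / (bp + dp))" by simp
    then show ?thesis
      unfolding P using True by (simp add: b_def c_def d_def power_add power2_eq_square algebra_simps)
  next
    case False
    define k where "k = nat (1 - n)"
    have n: "n = 1 - int k" using False by (simp add: k_def)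
    have P: "P n = bwd y k" "P (n - 1) = bwd y (Suc k)" "P (n - 2) = bwd y (Suc (Suc k))"
      using P_back[of k] P_back[of "Suc k"] P_back[of "Suc (Suc k)"] by (simp_all add: n)
    have "2 * b n * b (n - 2) / d (n - 2) * bwd y (Suc (Suc k)) = b n * bwd y k + c (n - 1) * bwd y (Suc k)"
      using b_pos[of n] b_pos[of "n-2"] d_pos[of "n-2"] by (simp add: n bwd.simps(3))
    then show ?thesis unfolding P by simp
  qed
  have gPr: "geometric y (\<lambda>k. P (int k))"
    by (rule geometric_of_ratio[where K=0]) (use y01 in \<open>auto simp: P_def nat_add_distrib\<close>)
  have gback: "geometric x (bwd y)"
  proof -
    \<comment> \<open>Two consecutive ratios to \<open>x ^ k\<close> suffice: a recurrence with
      positive coefficients that \<open>x ^ k\<close> also solves preserves upper and lower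
      comparison. From index \<open>2\<close> on, all coefficients involved are those of the left
      bulk.\<close>
    define A where "A = min (bwd y 2 / x ^ 2) (bwd y 3 / x ^ 3)"
    define B where "B = max (bwd y 2 / x ^ 2) (bwd y 3 / x ^ 3)"
    have step: "bwd y (k + 2) = r' / 2 * (bwd y k + r' * bwd y (k + 1))" if "k \<ge> 2" for k
    proof -
      have "b (1 - int k) = bm" "b (- 1 - int k) = bm" "c (- int k) = bm + dm" "d (- 1 - int k) = bm + dm"
        using that by (auto simp: b_def c_def d_def)
      then show ?thesis using bm by (simp add: bwd.simps r'_def field_simps)
    qed
    have xstep: "x ^ (k + 2) = r' / 2 * (x ^ k + r' * x ^ (k + 1))" for k
    proof -
      have "x\<^sup>2 = r' / 2 * (1 + r' * x)" using x(3) r' by (simp add: field_simps)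
      then have "x ^ k * x\<^sup>2 = x ^ k * (r' / 2 * (1 + r' * x))" by simp
      then show ?thesis by (simp add: power_add power2_eq_square algebra_simps)
    qed
    have base: "A * x ^ j \<le> bwd y j" "bwd y j \<le> B * x ^ j" if "j = 2 \<or> j = 3" for j
    proof -
      have "A \<le> bwd y j / x ^ j" "bwd y j / x ^ j \<le> B" using that by (auto simp: A_def B_def)
      then show "A * x ^ j \<le> bwd y j" "bwd y j \<le> B * x ^ j" using x01 by (simp_all add: field_simps)
    qed
    have "A * x ^ (k + 2) \<le> bwd y (k + 2) \<and> bwd y (k + 2) \<le> B * x ^ (k + 2)" for k
    proof (induction k rule: less_induct)
      case (less k)
      consider "k = 0" | "k = 1" | j where "k = j + 2"
        by (metis One_nat_def Suc_1 add.commute add_2_eq_Suc not0_implies_Suc)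
      then show ?case
      proof cases
        case 1
        then have "k + 2 = 2" by simp
        then show ?thesis using base[of 2] by metis
      next
        case 2
        then have "k + 2 = 3" by simp
        then show ?thesis using base[of 3] by metis
      next
        case (3 j)
        have ih: "A * x ^ (j + 2) \<le> bwd y (j + 2)" "bwd y (j + 2) \<le> B * x ^ (j + 2)"
          "A * x ^ (j + 2 + 1) \<le> bwd y (j + 2 + 1)" "bwd y (j + 2 + 1) \<le> B * x ^ (j + 2 + 1)"
          using less.IH[of j] less.IH[of "j + 1"] 3 by (auto simp: add_ac)
        have k: "k + 2 = (j + 2) + 2" using 3 by simp
        have "A * x ^ (k + 2) = r' / 2 * (A * x ^ (j + 2) + r' * (A * x ^ (j + 2 + 1)))"
          unfolding k xstep[of "j + 2"] by (simp add: algebra_simps)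
        also have "\<dots> \<le> r' / 2 * (bwd y (j + 2) + r' * bwd y (j + 2 + 1))"
          using r' ih by (intro mult_left_mono add_mono) auto
        also have "\<dots> = bwd y (k + 2)" unfolding k by (rule step[symmetric]) simp
        finally have 1: "A * x ^ (k + 2) \<le> bwd y (k + 2)" .
        have "bwd y (k + 2) = r' / 2 * (bwd y (j + 2) + r' * bwd y (j + 2 + 1))"
          unfolding k by (rule step) simp
        also have "\<dots> \<le> r' / 2 * (B * x ^ (j + 2) + r' * (B * x ^ (j + 2 + 1)))"
          using r' ih by (intro mult_left_mono add_mono) auto
        also have "\<dots> = B * x ^ (k + 2)"
          unfolding k xstep[of "j + 2"] by (simp add: algebra_simps)
        finally show ?thesis using 1 by simp
      qed
    qed
    then have ab: "A * x ^ k \<le> bwd y k \<and> bwd y k \<le> B * x ^ k" if "k \<ge> 2" for k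
      using that by (metis le_add_diff_inverse2)
    have "A > 0" using x01 bwd_pos[OF y01(1)] by (simp add: A_def)
    from geometric_eventuallyI[OF x01(1) bwd_pos[OF y01(1)] this ab] show ?thesis .
  qed
  have gPl: "geometric x (\<lambda>k. P (- int k))"
  proof -
    have "P (- int k) = bwd y (Suc k)" for k using P_back[of "Suc k"] by simp
    then show ?thesis using geometric_Suc[OF gback x01(1)] by simp
  qed
  have gPl': "geometric x (\<lambda>k. P (- int k - 1))"
  proof -
    have "P (- int k - 1) = P (- int (Suc k))" for k by (rule arg_cong[of _ _ P]) simp
    then show ?thesis using geometric_Suc[OF gPl x01(1)] by simp
  qed
  have gPr': "geometric y (\<lambda>k. P (int k - 1))"
    by (rule geometric_of_Suc) (use gPr y01 P_pos in auto)

  \<comment> \<open>The ratios of \<open>B\<close> are the product of the two first-order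
    coefficients; dividing by \<open>P\<close>, shifted by one site, removes the one that belongs to
    \<open>P\<close>.\<close>
  obtain B where B: "\<And>n. B n > 0" "\<And>n. B (n + 1) = 2 * b (n - 1) / d (n - 1) * B n"
    using int_recurrence_exists[of "\<lambda>n. 2 * b (n - 1) / d (n - 1)"] b_pos d_pos
    by (metis divide_pos_pos mult_pos_pos zero_less_numeral)
  have gBr: "geometric (2 / r) (\<lambda>k. B (int k))"
  proof (rule geometric_of_ratio[where K=1])
    show "B (int (Suc k)) = 2 / r * B (int k)" if "1 \<le> k" for k
      using B(2)[of "int k"] that by (simp add: b_def d_def r_def add.commute)
  qed (use r B in auto)
  have gBl: "geometric (r' / 2) (\<lambda>k. B (- int k))"
  proof (rule geometric_of_ratio[where K=1])
    show "B (- int (Suc k)) = r' / 2 * B (- int k)" if "1 \<le> k" for k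
    proof -
      have "B (- int k) = 2 * bm / (bm + dm) * B (- int (Suc k))"
        using B(2)[of "- int (Suc k)"] that by (simp add: b_def d_def)
      then show ?thesis using bm bdm by (simp add: r'_def)
    qed
  qed (use r' B in auto)
  define W where "W n = B n / P (n - 1)" for n
  have W_pos: "W n > 0" for n using B P_pos by (simp add: W_def)
  have W_ratio: "W n / W (n - 1) = 2 * b (n - 2) / d (n - 2) * P (n - 2) / P (n - 1)" for n
  proof -
    have "W n / W (n - 1) = (B n / B (n - 1)) * P (n - 2) / P (n - 1)"
      by (simp add: W_def diff_diff_eq)
    also have "B n / B (n - 1) = 2 * b (n - 2) / d (n - 2)"
      using B(2)[of "n - 1"] B(1)[of "n - 1"] by (simp add: field_simps)
    finally show ?thesis .
  qed
  have gWr: "geometric (y / (2 / r)) (\<lambda>k. 1 / W (int k))"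
    using geometric_divide[OF gPr' gBr] y01 r by (simp add: W_def)
  have gWl: "geometric (r' / 2 / x) (\<lambda>k. W (- int k))"
    using geometric_divide[OF gBl gPl'] x01 r' by (simp add: W_def)
  \<comment> \<open>The product of the two characteristic roots: the negative one has modulus
    \<open>y + r > 1\<close>, so \<open>2 / r\<close> exceeds \<open>y\<close>.\<close>
  have "2 / r = y * (y + r)" using y(3) by (simp add: power2_eq_square algebra_simps)
  moreover have "y * 1 < y * (y + r)" using y01 r by (intro mult_strict_left_mono) auto
  ultimately have "y < 2 / r" by simp
  then have wr: "0 < y / (2 / r)" "y / (2 / r) < 1" using y01 r by (simp_all add: field_simps)
  have "1 < 2 / r' * x"
  proof -
    have "2 / r' * x * x = 1 + r' * x" using x(3) by (simp add: power2_eq_square algebra_simps)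
    moreover have "1 + r' * x > x" using x01 mult_pos_pos[OF r'(1) x01(1)] by linarith
    ultimately have "2 / r' * x * x > 1 * x" by simp
    then show ?thesis using x01 by (simp only: mult_less_cancel_right)
  qed
  then have wl: "0 < r' / 2 / x" "r' / 2 / x < 1" using x01 r' by (auto simp: field_simps)
  define \<rho> where "\<rho> = max (max x y) (max (y / (2 / r)) (r' / 2 / x))"
  show ?thesis
  proof (rule that[of \<rho> P W])
    show "0 < \<rho>" using x01 by (simp add: \<rho>_def less_max_iff_disj)
    show "\<rho> < 1" using x01 y01 wr wl by (simp add: \<rho>_def)
    show "decay_weight \<rho>' P" if "\<rho> \<le> \<rho>'" for \<rho>'
      by (rule decay_weight_geometric[OF P_pos _ gPr _ _ gPl]) (use x01 y01 that in \<open>auto simp: \<rho>_def\<close>)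
    show "growth_weight \<rho>' W" if "\<rho> \<le> \<rho>'" for \<rho>'
      by (rule growth_weight_geometric[OF W_pos _ gWr _ _ gWl]) (use x01 wr wl that in \<open>auto simp: \<rho>_def\<close>)
  qed (fact P_rec W_ratio)+
qed

end

section \<open>Bounds and normalisation of the zero modes\<close>

lemma decay_weight_pos: "decay_weight \<rho> \<omega> \<Longrightarrow> \<omega> n > 0"
  by (simp add: decay_weight_def)

lemma decay_weight_bound:
  assumes "decay_weight \<rho> \<omega>"
  obtains C where "C \<ge> 0" "\<And>n. \<bar>\<omega> n\<bar> \<le> C * \<rho> ^ nat \<bar>n\<bar>"
proof -
  obtain C where C: "\<And>m n. 0 \<le> m \<Longrightarrow> m \<le> n \<Longrightarrow> \<omega> n \<le> C * \<rho> ^ nat (n - m) * \<omega> m"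
      "\<And>m n. n \<le> m \<Longrightarrow> m \<le> 0 \<Longrightarrow> \<omega> n \<le> C * \<rho> ^ nat (m - n) * \<omega> m"
    using assms unfolding decay_weight_def by blast
  have pos: "\<omega> n > 0" for n using decay_weight_pos[OF assms] .
  have "\<bar>\<omega> n\<bar> \<le> (C * \<omega> 0) * \<rho> ^ nat \<bar>n\<bar>" for n
    using C(1)[of 0 n] C(2)[of n 0] pos[of n] by (cases "n \<ge> 0") (simp_all add: mult_ac)
  moreover have "C * \<omega> 0 \<ge> 0" using C(1)[of 0 0] pos[of 0] by simp
  ultimately show ?thesis using that by blast
qed

lemma decay_weight_scale:
  assumes "decay_weight \<rho> \<omega>" "t > 0"
  shows "decay_weight \<rho> (\<lambda>n. t * \<omega> n)"
proof -
  obtain C where C: "\<And>m n. 0 \<le> m \<Longrightarrow> m \<le> n \<Longrightarrow> \<omega> n \<le> C * \<rho> ^ nat (n - m) * \<omega> m"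
      "\<And>m n. n \<le> m \<Longrightarrow> m \<le> 0 \<Longrightarrow> \<omega> n \<le> C * \<rho> ^ nat (m - n) * \<omega> m"
    using assms unfolding decay_weight_def by blast
  have "t * \<omega> n \<le> C * \<rho> ^ nat (n - m) * (t * \<omega> m)" if "0 \<le> m" "m \<le> n" for m n
    using mult_left_mono[OF C(1)[OF that], of t] assms(2) by (simp add: mult_ac)
  moreover have "t * \<omega> n \<le> C * \<rho> ^ nat (m - n) * (t * \<omega> m)" if "n \<le> m" "m \<le> 0" for m n
    using mult_left_mono[OF C(2)[OF that], of t] assms(2) by (simp add: mult_ac)
  moreover have "t * \<omega> n > 0" for n using assms decay_weight_pos[OF assms(1)] by simp
  ultimately show ?thesis unfolding decay_weight_def by (intro conjI allI exI[of _ C] impI)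
qed

lemma infsum_pos:
  fixes x :: "int \<Rightarrow> real"
  assumes "x summable_on UNIV" "\<And>n. x n > 0"
  shows "infsum x UNIV > 0"
proof -
  have "infsum x {0} \<le> infsum x UNIV"
    using assms by (intro infsum_mono2) (auto intro: less_imp_le)
  then show ?thesis using assms(2)[of 0] by simp
qed

context interface
begin

lemma coef_bounds:
  obtains K where "K > 0" "\<And>n. \<bar>b n\<bar> \<le> K" "\<And>n. \<bar>c n\<bar> \<le> K" "\<And>n. \<bar>1 / b n\<bar> \<le> K"
    "\<And>n. \<bar>1 / c n\<bar> \<le> K" "\<And>n. \<bar>1 / d n\<bar> \<le> K"
proof -
  let ?S = "{bp, bm, bp + dp, bm + dm, cc, 1 / bp, 1 / bm, 1 / (bp + dp), 1 / (bm + dm), 1 / cc}"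
  define M where "M = Max ?S"
  have m: "x \<le> M" if "x \<in> ?S" for x using that unfolding M_def by (intro Max_ge) auto
  have abs: "\<bar>b n\<bar> = b n" "\<bar>c n\<bar> = c n" "\<bar>1 / b n\<bar> = 1 / b n" "\<bar>1 / c n\<bar> = 1 / c n" "\<bar>1 / d n\<bar> = 1 / d n" for n
    using b_pos[of n] c_pos[of n] d_pos[of n] by auto
  have mem: "b n \<in> ?S" "c n \<in> ?S" "1 / b n \<in> ?S" "1 / c n \<in> ?S" "1 / d n \<in> ?S" for n
    by (auto simp: b_def c_def d_def)
  have "\<bar>b n\<bar> \<le> M" "\<bar>c n\<bar> \<le> M" "\<bar>1 / b n\<bar> \<le> M" "\<bar>1 / c n\<bar> \<le> M" "\<bar>1 / d n\<bar> \<le> M" for n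
    unfolding abs by (rule m, rule mem)+
  moreover have "M > 0" by (rule less_le_trans[OF bp m]) simp
  ultimately show ?thesis using that by blast
qed

text \<open>Both modes are put under one rate, and the even one is rescaled. Its component 2 is
  \<open>- 2 * b n / d n\<close> times its components 1 and 3 two sites earlier, so
  \<open>1 + 2 * (b n / d n)\<^sup>2\<close> accounts for half its squared norm; the odd mode has
  components \<open>f\<close> and \<open>- f\<close> up to a phase, and half its squared norm is the
  left-hand sum. Equal norms make the two solvability conditions symmetric.\<close>

lemma zero_modes:
  obtains \<rho> f P W where "0 < \<rho>" "\<rho> < 1" "decay_weight \<rho> f" "decay_weight \<rho> P" "growth_weight \<rho> W"
    "\<And>n. c n * f (n + 1) = b n * f n"
    "\<And>n. b n * P n + c (n - 1) * P (n - 1) = 2 * b n * b (n - 2) / d (n - 2) * P (n - 2)"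
    "\<And>n. W n / W (n - 1) = 2 * b (n - 2) / d (n - 2) * P (n - 2) / P (n - 1)"
    "(\<Sum>\<^sub>\<infinity>n. f n * f n) = (\<Sum>\<^sub>\<infinity>n. P n * ((1 + 2 * (b n / d n)\<^sup>2) * P n))"
proof -
  obtain r1 f where f: "0 < r1" "r1 < 1" "\<And>r. r1 \<le> r \<Longrightarrow> decay_weight r f"
      "\<And>n. c n * f (n + 1) = b n * f n"
    using odd_mode by blast
  obtain r2 P W where P: "0 < r2" "r2 < 1"
    "\<And>r. r2 \<le> r \<Longrightarrow> decay_weight r P" "\<And>r. r2 \<le> r \<Longrightarrow> growth_weight r W"
    "\<And>n. b n * P n + c (n - 1) * P (n - 1) = 2 * b n * b (n - 2) / d (n - 2) * P (n - 2)"
    "\<And>n. W n / W (n - 1) = 2 * b (n - 2) / d (n - 2) * P (n - 2) / P (n - 1)"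
    using even_mode by blast
  define r where "r = max r1 r2"
  have r: "0 < r" "r < 1" "r1 \<le> r" "r2 \<le> r" using f P by (auto simp: r_def)
  have df: "decay_weight r f" and dP: "decay_weight r P" using f(3) P(3) r by auto
  have summ: "(\<lambda>n. a n * (\<omega> n * \<omega> n)) summable_on UNIV"
    if w: "decay_weight r \<omega>" and a: "\<And>n. \<bar>a n\<bar> \<le> A" for \<omega> and a :: "int \<Rightarrow> real" and A
  proof -
    obtain C where C: "C \<ge> 0" "\<And>n. \<bar>\<omega> n\<bar> \<le> C * r ^ nat \<bar>n\<bar>"
      using decay_weight_bound[OF w] by blast
    show ?thesis
    proof (rule summable_on_of_geometric_bound[of "r * r" _ "A * (C * C)"])
      show "\<bar>a n * (\<omega> n * \<omega> n)\<bar> \<le> A * (C * C) * (r * r) ^ nat \<bar>n\<bar>" for n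
      proof -
        have "\<bar>a n * (\<omega> n * \<omega> n)\<bar> \<le> A * ((C * r ^ nat \<bar>n\<bar>) * (C * r ^ nat \<bar>n\<bar>))"
          unfolding abs_mult using a[of n] C r by (intro mult_mono C) auto
        then show ?thesis by (simp add: power_mult_distrib mult_ac)
      qed
      show "r * r < 1" using r mult_strict_mono[of r 1 r 1] by simp
    qed simp
  qed
  obtain K where K: "K > 0" "\<And>n. \<bar>b n\<bar> \<le> K" "\<And>n. \<bar>c n\<bar> \<le> K" "\<And>n. \<bar>1 / b n\<bar> \<le> K"
    "\<And>n. \<bar>1 / c n\<bar> \<le> K" "\<And>n. \<bar>1 / d n\<bar> \<le> K"
    using coef_bounds by blast
  have a: "\<bar>1 + 2 * (b n / d n)\<^sup>2\<bar> \<le> 1 + 2 * (K * K)\<^sup>2" for n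
  proof -
    have "\<bar>b n / d n\<bar> \<le> K * K"
      using mult_mono[OF K(2)[of n] K(6)[of n]] K(1) by (simp add: abs_mult)
    then have "(b n / d n)\<^sup>2 \<le> (K * K)\<^sup>2" by (rule power2_le_iff_abs_le[THEN iffD2, rotated]) (use K in simp)
    then show ?thesis by simp
  qed
  define N where "N = (\<Sum>\<^sub>\<infinity>n. f n * f n)"
  define N' where "N' = (\<Sum>\<^sub>\<infinity>n. P n * ((1 + 2 * (b n / d n)\<^sup>2) * P n))"
  have "N > 0" unfolding N_def
    using summ[OF df, of "\<lambda>_. 1" 1] decay_weight_pos[OF df] by (intro infsum_pos) auto
  moreover have "N' > 0" unfolding N'_def
    using summ[OF dP a] decay_weight_pos[OF dP]
    by (intro infsum_pos) (auto simp: mult_ac intro!: mult_pos_pos add_pos_nonneg)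
  ultimately have t: "sqrt (N / N') > 0" "(sqrt (N / N'))\<^sup>2 * N' = N" by auto
  define t where "t = sqrt (N / N')"
  show ?thesis
  proof (rule that[of r f "\<lambda>n. t * P n" W])
    show "decay_weight r (\<lambda>n. t * P n)" using decay_weight_scale[OF dP] t t_def by simp
    show "b n * (t * P n) + c (n - 1) * (t * P (n - 1)) = 2 * b n * b (n - 2) / d (n - 2) * (t * P (n - 2))" for n
    proof -
      have "b n * (t * P n) + c (n - 1) * (t * P (n - 1)) = t * (b n * P n + c (n - 1) * P (n - 1))"
        by (simp add: algebra_simps)
      then show ?thesis unfolding P(5) by simp
    qed
    show "W n / W (n - 1) = 2 * b (n - 2) / d (n - 2) * (t * P (n - 2)) / (t * P (n - 1))" for n
      using P(6)[of n] t(1) unfolding t_def[symmetric] by simp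
    have "(\<lambda>n. t * P n * ((1 + 2 * (b n / d n)\<^sup>2) * (t * P n))) = (\<lambda>n. t\<^sup>2 * (P n * ((1 + 2 * (b n / d n)\<^sup>2) * P n)))"
      by (auto simp: power2_eq_square mult_ac)
    then show "(\<Sum>\<^sub>\<infinity>n. f n * f n) = (\<Sum>\<^sub>\<infinity>n. t * P n * ((1 + 2 * (b n / d n)\<^sup>2) * (t * P n)))"
      using t(2) by (simp only: infsum_cmult_right' t_def flip: N_def N'_def)
  qed (use r f P df in auto)
qed

end

section \<open>Green operators of the odd and even parts at zero momentum\<close>

locale interface_modes = interface bp bm dp dm cc + decay \<rho> \<sigma>
  for bp bm dp dm cc \<rho> \<sigma> :: real +
  fixes f0 P0 W0 :: "int \<Rightarrow> real"
  assumes f0_decay: "decay_weight \<rho> f0" and P0_decay: "decay_weight \<rho> P0"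
    and W0_growth: "growth_weight \<rho> W0"
    and f0_rec: "\<And>n. c n * f0 (n + 1) = b n * f0 n"
    and P0_rec: "\<And>n. b n * P0 n + c (n - 1) * P0 (n - 1) = 2 * b n * b (n - 2) / d (n - 2) * P0 (n - 2)"
    and W0_ratio: "\<And>n. W0 n / W0 (n - 1) = 2 * b (n - 2) / d (n - 2) * P0 (n - 2) / P0 (n - 1)"
    and normalisation: "(\<Sum>\<^sub>\<infinity>n. f0 n * f0 n) = (\<Sum>\<^sub>\<infinity>n. P0 n * ((1 + 2 * (b n / d n)\<^sup>2) * P0 n))"
begin

lemma f0_pos: "f0 n > 0" and P0_pos: "P0 n > 0"
  using f0_decay P0_decay by (auto simp: decay_weight_def)

text \<open>Division by \<open>c\<close> gives the first-order difference that annihilates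
  \<open>f0\<close>, which has a right inverse. The transpose is solved up to a multiple of the unit
  mass at site \<open>0\<close>, and this defect vanishes exactly when \<open>h\<close> is
  orthogonal to \<open>f0\<close>.\<close>

lemma odd_green:
  obtains G G' where "bounded_linear G" "bounded_linear G'"
    "\<And>h n. c n * sq (G h) (n + 1) - b n * sq (G h) n = sq h n"
    "\<And>h n. c (n - 1) * sq (G' h) (n - 1) - b n * sq (G' h) n
       = sq h n - (if n = 0 then (\<Sum>\<^sub>\<infinity>m. f0 m * sq h m) / f0 0 else 0)"
proof -
  obtain K where K: "K > 0" "\<And>n. \<bar>b n\<bar> \<le> K" "\<And>n. \<bar>c n\<bar> \<le> K" "\<And>n. \<bar>1 / b n\<bar> \<le> K"
    "\<And>n. \<bar>1 / c n\<bar> \<le> K" "\<And>n. \<bar>1 / d n\<bar> \<le> K"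
    using coef_bounds by blast
  obtain T where T: "bounded_linear T" "\<And>x n. sq (T x) n = 1 / c (n - 1) * sq x (n + - 1)"
    using shift_operator[of "\<lambda>n. 1 / c (n - 1)" K "-1", OF K(5)] by blast
  obtain T' where T': "bounded_linear T'" "\<And>x n. sq (T' x) n = 1 / c n * sq x (n + 1)"
    using shift_operator[of "\<lambda>n. 1 / c n" K 1, OF K(5)] by blast
  obtain C where C: "\<And>m n. 0 \<le> m \<Longrightarrow> m \<le> n \<Longrightarrow> f0 n \<le> C * \<rho> ^ nat (n - m) * f0 m"
      "\<And>m n. n \<le> m \<Longrightarrow> m \<le> 0 \<Longrightarrow> f0 n \<le> C * \<rho> ^ nat (m - n) * f0 m"
    using f0_decay unfolding decay_weight_def by blast
  obtain G G' where G: "bounded_linear G" "bounded_linear G'"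
    "\<And>h n. sq (G h) n - f0 n / f0 (n - 1) * sq (G h) (n - 1) = sq h n"
    "\<And>h n. sq (G' h) n - f0 (n + 1) / f0 n * sq (G' h) (n + 1)
       = sq h n - (if n = 0 then (\<Sum>\<^sub>\<infinity>m. f0 m * sq h m) / f0 0 else 0)"
    using green_two_sided_decay[OF f0_pos C] by blast
  have ratio: "f0 (n + 1) / f0 n = b n / c n" for n
    using f0_rec[of n] f0_pos[of n] c_pos[of n] by (simp add: field_simps)
  show ?thesis
  proof (rule that[of "\<lambda>h. G (T h)" "\<lambda>h. T' (G' h)"])
    show "bounded_linear (\<lambda>h. G (T h))" "bounded_linear (\<lambda>h. T' (G' h))"
      by (rule bounded_linear_compose[OF G(1) T(1)], rule bounded_linear_compose[OF T'(1) G(2)])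
    show "c n * sq (G (T h)) (n + 1) - b n * sq (G (T h)) n = sq h n" for h n
    proof -
      have "sq (G (T h)) (n + 1) - b n / c n * sq (G (T h)) n = sq h n / c n"
        using G(3)[of "T h" "n + 1"] by (simp add: T ratio)
      then show ?thesis using c_pos[of n] by (simp add: field_simps)
    qed
    show "c (n - 1) * sq (T' (G' h)) (n - 1) - b n * sq (T' (G' h)) n
       = sq h n - (if n = 0 then (\<Sum>\<^sub>\<infinity>m. f0 m * sq h m) / f0 0 else 0)" for h n
    proof -
      have "c (n - 1) * sq (T' (G' h)) (n - 1) - b n * sq (T' (G' h)) n
        = sq (G' h) n - f0 (n + 1) / f0 n * sq (G' h) (n + 1)"
        using c_pos[of "n - 1"] by (simp add: T' ratio)
      then show ?thesis unfolding G(4) .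
    qed
  qed
qed

text \<open>The even three-term operator factors as
  \<open>b\<^sub>n (1 + \<theta>\<^sub>n S\<^sup>-\<^sup>1) (1 - \<phi>\<^sub>n S\<^sup>-\<^sup>1)\<close> with \<open>\<phi>\<^sub>n = P0\<^sub>n / P0\<^sub>n\<^sub>-\<^sub>1\<close> and \<open>\<theta>\<^sub>n = W0\<^sub>n / W0\<^sub>n\<^sub>-\<^sub>1\<close>,
  where \<open>S\<^sup>-\<^sup>1\<close> is the backward shift.\<close>

lemma even_green:
  obtains G G' where "bounded_linear G" "bounded_linear G'"
    "\<And>h n. b n * sq (G h) n + c (n - 1) * sq (G h) (n - 1)
       - 2 * b n * b (n - 2) / d (n - 2) * sq (G h) (n - 2) = sq h n"
    "\<And>h n. b n * sq (G' h) n + c n * sq (G' h) (n + 1)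
       - 2 * b n * b (n + 2) / d n * sq (G' h) (n + 2)
       = sq h n - (if n = 0 then (\<Sum>\<^sub>\<infinity>m. P0 m * sq h m) / P0 0 else 0)"
proof -
  obtain K where K: "K > 0" "\<And>n. \<bar>b n\<bar> \<le> K" "\<And>n. \<bar>c n\<bar> \<le> K" "\<And>n. \<bar>1 / b n\<bar> \<le> K"
    "\<And>n. \<bar>1 / c n\<bar> \<le> K" "\<And>n. \<bar>1 / d n\<bar> \<le> K"
    using coef_bounds by blast
  obtain T where T: "bounded_linear T" "\<And>x n. sq (T x) n = 1 / b n * sq x (n + 0)"
    using shift_operator[of "\<lambda>n. 1 / b n" K 0, OF K(4)] by blast
  obtain C where C: "\<And>m n. 0 \<le> m \<Longrightarrow> m \<le> n \<Longrightarrow> P0 n \<le> C * \<rho> ^ nat (n - m) * P0 m"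
      "\<And>m n. n \<le> m \<Longrightarrow> m \<le> 0 \<Longrightarrow> P0 n \<le> C * \<rho> ^ nat (m - n) * P0 m"
    using P0_decay unfolding decay_weight_def by blast
  obtain A A' where A: "bounded_linear A" "bounded_linear A'"
    "\<And>h n. sq (A h) n - P0 n / P0 (n - 1) * sq (A h) (n - 1) = sq h n"
    "\<And>h n. sq (A' h) n - P0 (n + 1) / P0 n * sq (A' h) (n + 1)
       = sq h n - (if n = 0 then (\<Sum>\<^sub>\<infinity>m. P0 m * sq h m) / P0 0 else 0)"
    using green_two_sided_decay[OF P0_pos C] by blast
  \<comment> \<open>The alternating sign makes the growing solution fit the factor with
    \<open>+ \<theta>\<close>; the moduli and hence the growth bound stay the same.\<close>
  define W where "W n = (if even n then 1 else -1) * W0 n" for n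
  have W0: "W0 n > 0" for n using W0_growth by (simp add: growth_weight_def)
  obtain D where D: "\<And>m n. n \<le> m \<Longrightarrow> W0 n \<le> D * \<rho> ^ nat (m - n) * W0 m"
    using W0_growth unfolding growth_weight_def by blast
  have W: "W n \<noteq> 0" "\<bar>W n\<bar> = W0 n" "W n / W (n - 1) = - (W0 n / W0 (n - 1))" for n
    using W0[of n] by (auto simp: W_def abs_mult)
  obtain B B' where B: "bounded_linear B" "bounded_linear B'"
    "\<And>h n. sq (B h) n - W n / W (n - 1) * sq (B h) (n - 1) = sq h n"
    "\<And>h n. sq (B' h) n - W (n + 1) / W n * sq (B' h) (n + 1) = sq h n"
  proof (rule green_growing[of W D])
    show "\<bar>W n\<bar> \<le> D * \<rho> ^ nat (m - n) * \<bar>W m\<bar>" if "n \<le> m" for m n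
      unfolding W(2) by (rule D[OF that])
  qed (use W(1) in blast)+
  define \<phi> where "\<phi> n = P0 n / P0 (n - 1)" for n
  define \<theta> where "\<theta> n = W0 n / W0 (n - 1)" for n
  have B3: "sq (B h) n + \<theta> n * sq (B h) (n - 1) = sq h n"
    and B4: "sq (B' h) n + \<theta> (n + 1) * sq (B' h) (n + 1) = sq h n" for h n
  proof -
    have "W n / W (n - 1) = - \<theta> n" "W (n + 1) / W n = - \<theta> (n + 1)"
      using W(3)[of n] W(3)[of "n + 1"] by (simp_all add: \<theta>_def)
    note eq = this
    show "sq (B h) n + \<theta> n * sq (B h) (n - 1) = sq h n" using B(3)[of h n] unfolding eq by simp
    show "sq (B' h) n + \<theta> (n + 1) * sq (B' h) (n + 1) = sq h n" using B(4)[of h n] unfolding eq by simp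
  qed
  have A3: "sq (A h) n - \<phi> n * sq (A h) (n - 1) = sq h n"
    and A4: "sq (A' h) n - \<phi> (n + 1) * sq (A' h) (n + 1)
       = sq h n - (if n = 0 then (\<Sum>\<^sub>\<infinity>m. P0 m * sq h m) / P0 0 else 0)" for h n
    using A(3)[of h n] A(4)[of h n] by (simp_all add: \<phi>_def)
  \<comment> \<open>Coefficient matching for the product of the two factors: \<open>prod\<close> is
    its second-order term and \<open>diff\<close> its first-order term. The latter is a discrete
    Riccati equation for \<open>\<phi>\<close>, equivalent to the recurrence of
    \<open>P0\<close>.\<close>
  have prod: "\<theta> n * \<phi> (n - 1) = 2 * b (n - 2) / d (n - 2)" for n
    using P0_pos[of "n - 1"] P0_pos[of "n - 2"] by (simp add: \<theta>_def \<phi>_def W0_ratio diff_diff_eq)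
  have diff: "\<theta> n - \<phi> n = c (n - 1) / b n" for n
  proof -
    have "\<theta> n = (2 * b n * b (n - 2) / d (n - 2) * P0 (n - 2)) / (b n * P0 (n - 1))"
      using b_pos[of n] by (simp add: \<theta>_def W0_ratio)
    also have "\<dots> = \<phi> n + c (n - 1) / b n"
      unfolding P0_rec[symmetric] using b_pos[of n] P0_pos[of "n - 1"] by (simp add: \<phi>_def field_simps)
    finally show ?thesis by simp
  qed
  show ?thesis
  proof (rule that[of "\<lambda>h. A (B (T h))" "\<lambda>h. T (B' (A' h))"])
    show "bounded_linear (\<lambda>h. A (B (T h)))"
      by (rule bounded_linear_compose[OF A(1) bounded_linear_compose[OF B(1) T(1)]])
    show "bounded_linear (\<lambda>h. T (B' (A' h)))"
      by (rule bounded_linear_compose[OF T(1) bounded_linear_compose[OF B(2) A(2)]])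
    show "b n * sq (A (B (T h))) n + c (n - 1) * sq (A (B (T h))) (n - 1)
       - 2 * b n * b (n - 2) / d (n - 2) * sq (A (B (T h))) (n - 2) = sq h n" for h n
    proof -
      define x where "x = sq (A (B (T h)))"
      have y: "sq (B (T h)) n = x n - \<phi> n * x (n - 1)" for n by (simp add: x_def A3)
      have "x n - \<phi> n * x (n - 1) + \<theta> n * (x (n - 1) - \<phi> (n - 1) * x (n - 2)) = sq h n / b n"
        using B3[of "T h" n] unfolding y by (simp add: T diff_diff_eq)
      then have "x n + (\<theta> n - \<phi> n) * x (n - 1) - \<theta> n * \<phi> (n - 1) * x (n - 2) = sq h n / b n"
        by (simp add: algebra_simps)
      then have "b n * (x n + c (n - 1) / b n * x (n - 1) - 2 * b (n - 2) / d (n - 2) * x (n - 2)) = sq h n"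
        unfolding prod diff using b_pos[of n] by simp
      then show ?thesis using b_pos[of n] by (simp add: x_def[symmetric] distrib_left right_diff_distrib mult_ac)
    qed
    show "b n * sq (T (B' (A' h))) n + c n * sq (T (B' (A' h))) (n + 1)
       - 2 * b n * b (n + 2) / d n * sq (T (B' (A' h))) (n + 2)
       = sq h n - (if n = 0 then (\<Sum>\<^sub>\<infinity>m. P0 m * sq h m) / P0 0 else 0)" for h n
    proof -
      define x where "x = sq (B' (A' h))"
      have y: "sq (A' h) n = x n + \<theta> (n + 1) * x (n + 1)" for n by (simp add: x_def B4)
      have t: "sq (T (B' (A' h))) n = x n / b n" for n by (simp add: T x_def)
      \<comment> \<open>Transposition reverses the order, so the factor of \<open>P0\<close> acts
        last and its defect is that of the full operator.\<close>
      have "sq (A' h) n - \<phi> (n + 1) * sq (A' h) (n + 1)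
        = x n + (\<theta> (n + 1) - \<phi> (n + 1)) * x (n + 1) - \<theta> (n + 2) * \<phi> (n + 2 - 1) * x (n + 2)"
        unfolding y by (simp add: algebra_simps)
      also have "\<dots> = x n + c n / b (n + 1) * x (n + 1) - 2 * b n / d n * x (n + 2)"
        unfolding prod diff by simp
      also have "\<dots> = b n * (x n / b n) + c n * (x (n + 1) / b (n + 1))
          - 2 * b n * b (n + 2) / d n * (x (n + 2) / b (n + 2))"
        using b_pos[of n] b_pos[of "n + 2"] by simp
      finally show ?thesis unfolding t A4 by simp
    qed
  qed
qed

end

section \<open>The perturbed system\<close>

type_synonym unknowns =
  "(int discrete \<Rightarrow>\<^sub>C real) \<times> (int discrete \<Rightarrow>\<^sub>C real) \<times> (int discrete \<Rightarrow>\<^sub>C real) \<times> (int discrete \<Rightarrow>\<^sub>C real) \<times> (int discrete \<Rightarrow>\<^sub>C real) \<times> real \<times> real"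

context interface_modes
begin

lemmas lip_bounded_intros =
  lip_bounded_const lip_bounded_add lip_bounded_diff lip_bounded_minus lip_bounded_scaleR lip_bounded_mult

text \<open>The real form of \<open>H w = E w\<close> with \<open>\<mu> = \<kappa>\<^sup>2\<close>, \<open>cos \<kappa> = 1 - \<mu> g\<close>, \<open>sin \<kappa> = \<kappa> s\<close> and \<open>E = \<kappa> \<eta>\<close>, after
  division of the subleading amplitudes \<open>p\<close>, \<open>q\<close>, \<open>F\<close> by \<open>\<kappa>\<close>.\<close>

definition perturbed_system :: "real \<Rightarrow> real \<Rightarrow> real \<Rightarrow> real \<Rightarrow> (int \<Rightarrow> real) \<Rightarrow> (int \<Rightarrow> real) \<Rightarrow>
    (int \<Rightarrow> real) \<Rightarrow> (int \<Rightarrow> real) \<Rightarrow> (int \<Rightarrow> real) \<Rightarrow> (int \<Rightarrow> real) \<Rightarrow> bool" where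
  "perturbed_system \<mu> s g \<eta> f p q P Q F \<longleftrightarrow> (\<forall>n.
     c n * f (n + 1) - b n * f n = \<mu> * (g * c n * f (n + 1) - s * c n * p (n + 1) + \<eta> * F n) \<and>
     b n * (p n + q n) + c n * p (n + 1) = s * c n * f (n + 1) + \<eta> * P n + \<mu> * g * c n * p (n + 1) \<and>
     2 * b n * p n + d (n - 2) * q (n - 2) = \<eta> * Q n \<and>
     b n * (P n + Q n) + c (n - 1) * P (n - 1)
       = \<mu> * (g * c (n - 1) * P (n - 1) - s * c (n - 1) * F (n - 1) + \<eta> * p n) \<and>
     2 * b n * P n + d n * Q (n + 2) = \<mu> * \<eta> * q n \<and>
     c (n - 1) * F (n - 1) - b n * F n
       = s * c (n - 1) * P (n - 1) + \<eta> * f n + \<mu> * g * c (n - 1) * F (n - 1))"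

text \<open>With \<open>f = f0 + \<mu> ft\<close>, \<open>P = \<beta> P0 + \<mu> Pt\<close>, \<open>\<eta> = \<eta>0 + \<mu> \<eta>'\<close>, \<open>\<beta> = 1 + \<mu> \<beta>'\<close> all unknowns enter the right
  hand sides only through \<open>\<mu>\<close> times themselves, except for the product \<open>\<mu> \<eta>' \<beta>'\<close>, which becomes \<open>U\<close>
  below. The solvability conditions are \<open>\<beta> S + \<eta> N + \<mu> d1 = 0\<close> and \<open>S + \<eta> \<beta> N + \<mu> d2 = 0\<close>; their sum
  and difference are solved for \<open>\<eta>'\<close> and \<open>\<beta>'\<close>.\<close>

lemma perturbed_solution:
  obtains \<eta>0 R \<mu>0 :: real where "\<eta>0 \<noteq> 0" "R > 0" "\<mu>0 > 0"
    "\<forall>\<mu> s1 g. 0 \<le> \<mu> \<and> \<mu> \<le> \<mu>0 \<and> \<bar>s1\<bar> \<le> 1 \<and> \<bar>g\<bar> \<le> 1 \<longrightarrow>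
      (\<exists>\<eta> f p q P Q F. \<bar>\<eta> - \<eta>0\<bar> \<le> R * \<mu> \<and> sq f 0 \<noteq> 0 \<and>
        perturbed_system \<mu> (1 - \<mu> * s1) g \<eta> (sq f) (sq p) (sq q) (sq P) (sq Q) (sq F))"
proof -
  obtain GA GAT where GA: "bounded_linear GA" "bounded_linear GAT"
    "\<And>h n. c n * sq (GA h) (n + 1) - b n * sq (GA h) n = sq h n"
    "\<And>h n. c (n - 1) * sq (GAT h) (n - 1) - b n * sq (GAT h) n
       = sq h n - (if n = 0 then (\<Sum>\<^sub>\<infinity>m. f0 m * sq h m) / f0 0 else 0)"
    using odd_green by blast
  obtain GM GMT where GM: "bounded_linear GM" "bounded_linear GMT"
    "\<And>h n. b n * sq (GM h) n + c (n - 1) * sq (GM h) (n - 1)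
       - 2 * b n * b (n - 2) / d (n - 2) * sq (GM h) (n - 2) = sq h n"
    "\<And>h n. b n * sq (GMT h) n + c n * sq (GMT h) (n + 1)
       - 2 * b n * b (n + 2) / d n * sq (GMT h) (n + 2)
       = sq h n - (if n = 0 then (\<Sum>\<^sub>\<infinity>m. P0 m * sq h m) / P0 0 else 0)"
    using even_green by blast
  obtain K where K: "K > 0" "\<And>n. \<bar>b n\<bar> \<le> K" "\<And>n. \<bar>c n\<bar> \<le> K" "\<And>n. \<bar>1 / b n\<bar> \<le> K"
    "\<And>n. \<bar>1 / c n\<bar> \<le> K" "\<And>n. \<bar>1 / d n\<bar> \<le> K"
    using coef_bounds by blast
  have KK: "\<bar>b m / d n\<bar> \<le> K * K" for m n
    using mult_mono[OF K(2)[of m] K(6)[of n]] K(1) by (simp add: abs_mult)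
  have KK2: "\<bar>2 * (b m / d n)\<bar> \<le> 2 * (K * K)" for m n
    using KK[of m n] by linarith
  \<comment> \<open>Weighted shifts for the eliminations: the fifth equation gives \<open>Q\<close>
    through \<open>SQ\<close> and \<open>DQ\<close>, the third gives \<open>q\<close> through
    \<open>Sq\<close> and \<open>Dq\<close>; inserting them in the second and fourth leaves the
    terms with \<open>B2\<close> and \<open>B3\<close>.\<close>
  obtain C1 where C1: "bounded_linear C1" "\<And>x n. sq (C1 x) n = c n * sq x (n + 1)"
    using shift_operator[of c K 1, OF K(3)] by blast
  obtain Cs where Cs: "bounded_linear Cs" "\<And>x n. sq (Cs x) n = c (n - 1) * sq x (n + - 1)"
    using shift_operator[of "\<lambda>n. c (n - 1)" K "- 1", OF K(3)] by blast
  obtain DQ where DQ: "bounded_linear DQ" "\<And>x n. sq (DQ x) n = 2 * (b (n - 2) / d (n - 2)) * sq x (n + - 2)"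
    using shift_operator[of "\<lambda>n. 2 * (b (n - 2) / d (n - 2))" "2 * (K * K)" "- 2", OF KK2] by blast
  obtain SQ where SQ: "bounded_linear SQ" "\<And>x n. sq (SQ x) n = 1 / d (n - 2) * sq x (n + - 2)"
    using shift_operator[of "\<lambda>n. 1 / d (n - 2)" K "- 2", OF K(6)] by blast
  obtain B2 where B2: "bounded_linear B2" "\<And>x n. sq (B2 x) n = b n / d n * sq x (n + 2)"
    using shift_operator[of "\<lambda>n. b n / d n" "K * K" 2, OF KK] by blast
  obtain B3 where B3: "bounded_linear B3" "\<And>x n. sq (B3 x) n = b n / d (n - 2) * sq x (n + - 2)"
    using shift_operator[of "\<lambda>n. b n / d (n - 2)" "K * K" "- 2", OF KK] by blast
  obtain Sq where Sq: "bounded_linear Sq" "\<And>x n. sq (Sq x) n = 1 / d n * sq x (n + 2)"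
    using shift_operator[of "\<lambda>n. 1 / d n" K 2, OF K(6)] by blast
  obtain Dq where Dq: "bounded_linear Dq" "\<And>x n. sq (Dq x) n = 2 * (b (n + 2) / d n) * sq x (n + 2)"
    using shift_operator[of "\<lambda>n. 2 * (b (n + 2) / d n)" "2 * (K * K)" 2, OF KK2] by blast
  obtain Cf where Cf: "Cf \<ge> 0" "\<And>n. \<bar>f0 n\<bar> \<le> Cf * \<rho> ^ nat \<bar>n\<bar>"
    using decay_weight_bound[OF f0_decay] by blast
  obtain CP where CP: "CP \<ge> 0" "\<And>n. \<bar>P0 n\<bar> \<le> CP * \<rho> ^ nat \<bar>n\<bar>"
    using decay_weight_bound[OF P0_decay] by blast
  obtain \<phi>f where \<phi>f: "bounded_linear \<phi>f" "\<And>x. \<phi>f x = (\<Sum>\<^sub>\<infinity>m. f0 m * sq x m)"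
    using pairing_functional[of f0 Cf, OF Cf(2)] by blast
  obtain \<phi>P where \<phi>P: "bounded_linear \<phi>P" "\<And>x. \<phi>P x = (\<Sum>\<^sub>\<infinity>m. P0 m * sq x m)"
    using pairing_functional[of P0 CP, OF CP(2)] by blast
  have rs: "\<rho> ^ k \<le> \<sigma> ^ k" for k using rho_pos rho_less by (intro power_mono) auto
  have "\<bar>f0 n\<bar> \<le> Cf * \<sigma> ^ nat \<bar>n\<bar>" for n
    using Cf(2)[of n] mult_left_mono[OF rs Cf(1), of "nat \<bar>n\<bar>"] by linarith
  then obtain fe where fe: "sq fe = f0" using sq_exists[of f0 Cf] by blast
  have "\<bar>P0 n\<bar> \<le> CP * \<sigma> ^ nat \<bar>n\<bar>" for n
    using CP(2)[of n] mult_left_mono[OF rs CP(1), of "nat \<bar>n\<bar>"] by linarith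
  then obtain Pe where Pe: "sq Pe = P0" using sq_exists[of P0 CP] by blast

  define N where "N = \<phi>f fe"
  define S where "S = \<phi>P (C1 fe)"
  have summ: "(\<lambda>m. f0 m * sq x m) summable_on UNIV" "(\<lambda>m. P0 m * sq x m) summable_on UNIV" for x
  proof -
    have 1: "\<bar>if n = 0 then f0 m else 0\<bar> \<le> Cf * \<rho> ^ nat \<bar>n - m\<bar>"
     and 2: "\<bar>if n = 0 then P0 m else 0\<bar> \<le> CP * \<rho> ^ nat \<bar>n - m\<bar>" for n m :: int
      using Cf(1) CP(1) Cf(2)[of m] CP(2)[of m] rho_pos by auto
    show "(\<lambda>m. f0 m * sq x m) summable_on UNIV" "(\<lambda>m. P0 m * sq x m) summable_on UNIV"
      using kernel_summable[of "\<lambda>n m. if n = 0 then f0 m else 0", OF 1, of 0 x]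
        kernel_summable[of "\<lambda>n m. if n = 0 then P0 m else 0", OF 2, of 0 x] by simp_all
  qed
  have N_pos: "N > 0" unfolding N_def \<phi>f(2)
    by (rule infsum_pos[OF summ(1)]) (simp add: fe f0_pos)
  have S_pos: "S > 0" unfolding S_def \<phi>P(2)
    by (rule infsum_pos[OF summ(2)]) (simp add: C1 fe f0_pos P0_pos c_pos)
  \<comment> \<open>A unit shift of the summation index shows that both solvability conditions
    contain the same overlap.\<close>
  have S_eq: "\<phi>f (Cs Pe) = S"
  proof -
    have "bij_betw (\<lambda>n::int. n + 1) UNIV UNIV" by (rule bij_betwI[of _ _ _ "\<lambda>n. n - 1"]) auto
    from infsum_reindex_bij_betw[OF this, of "\<lambda>m. f0 m * sq (Cs Pe) m"]
    have "\<phi>f (Cs Pe) = (\<Sum>\<^sub>\<infinity>n. f0 (n + 1) * (c n * P0 n))"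
      unfolding \<phi>f(2) by (simp add: Cs Pe)
    then show ?thesis unfolding S_def \<phi>P(2) by (simp add: C1 fe mult_ac)
  qed
  \<comment> \<open>The term with \<open>B2 (DQ Pe)\<close> is the share of component 2 in the norm
    of the even mode.\<close>
  have N_eq: "\<phi>P Pe + \<phi>P (B2 (DQ Pe)) = N"
  proof -
    have "\<phi>P Pe + \<phi>P (B2 (DQ Pe)) = \<phi>P (Pe + B2 (DQ Pe))"
      using \<phi>P(1) by (simp add: linear_add bounded_linear.linear)
    also have "\<dots> = (\<Sum>\<^sub>\<infinity>n. P0 n * ((1 + 2 * (b n / d n)\<^sup>2) * P0 n))"
      unfolding \<phi>P(2) by (simp add: sq_add B2 DQ Pe power2_eq_square algebra_simps)
    also have "\<dots> = N" unfolding N_def \<phi>f(2) by (simp add: fe normalisation)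
    finally show ?thesis .
  qed

  define \<eta>0 where "\<eta>0 = - S / N"
  have l0: "S + \<eta>0 * N = 0" "\<eta>0 \<noteq> 0" using N_pos S_pos by (auto simp: \<eta>0_def)

  \<comment> \<open>The argument of \<open>V\<close> holds the parameters and \<open>\<mu>\<close>
    times the unknowns. Thus \<open>zf\<close>, \<open>zP\<close>, \<open>zl\<close>,
    \<open>zb\<close> are the full corrections to the modes, the energy and the amplitude ratio, and
    \<open>zF\<close>, \<open>zp\<close>, \<open>zq\<close> are amplitudes with the factor
    \<open>\<mu>\<close> that they have on the right-hand sides.\<close>
  define mu where "mu y = fst (fst y)" for y :: "(real \<times> real \<times> real) \<times> unknowns"
  define s1 where "s1 y = fst (snd (fst y))" for y :: "(real \<times> real \<times> real) \<times> unknowns"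
  define g where "g y = snd (snd (fst y))" for y :: "(real \<times> real \<times> real) \<times> unknowns"
  define zF where "zF y = fst (snd y)" for y :: "(real \<times> real \<times> real) \<times> unknowns"
  define zp where "zp y = fst (snd (snd y))" for y :: "(real \<times> real \<times> real) \<times> unknowns"
  define zq where "zq y = fst (snd (snd (snd y)))" for y :: "(real \<times> real \<times> real) \<times> unknowns"
  define zf where "zf y = fst (snd (snd (snd (snd y))))" for y :: "(real \<times> real \<times> real) \<times> unknowns"
  define zP where "zP y = fst (snd (snd (snd (snd (snd y)))))" for y :: "(real \<times> real \<times> real) \<times> unknowns"
  define zl where "zl y = fst (snd (snd (snd (snd (snd (snd y))))))" for y :: "(real \<times> real \<times> real) \<times> unknowns"
  define zb where "zb y = snd (snd (snd (snd (snd (snd (snd y))))))" for y :: "(real \<times> real \<times> real) \<times> unknowns"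
  note z_defs = mu_def s1_def g_def zF_def zp_def zq_def zf_def zP_def zl_def zb_def
  have Lz: "lip_bounded mu" "lip_bounded s1" "lip_bounded g" "lip_bounded zF" "lip_bounded zp"
    "lip_bounded zq" "lip_bounded zf" "lip_bounded zP" "lip_bounded zl" "lip_bounded zb"
    unfolding z_defs by (intro lip_bounded_fst lip_bounded_snd lip_bounded_ident)+

  define s where "s y = 1 - mu y * s1 y" for y
  have Ls: "lip_bounded s" unfolding s_def by (intro lip_bounded_intros Lz)
  define lam where "lam y = \<eta>0 + zl y" for y
  have Llam: "lip_bounded lam" unfolding lam_def by (intro lip_bounded_intros Lz)
  define bet where "bet y = 1 + zb y" for y
  have Lbet: "lip_bounded bet" unfolding bet_def by (intro lip_bounded_intros Lz)
  define f where "f y = fe + zf y" for y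
  have Lf: "lip_bounded f" unfolding f_def by (intro lip_bounded_intros Lz)
  define P where "P y = bet y *\<^sub>R Pe + zP y" for y
  have LP: "lip_bounded P" unfolding P_def by (intro lip_bounded_intros Lz Lbet)
  define Q where "Q y = lam y *\<^sub>R SQ (zq y) - DQ (P y)" for y
  have LQ: "lip_bounded Q" unfolding Q_def
    by (intro lip_bounded_intros lip_bounded_bounded_linear[OF SQ(1)] lip_bounded_bounded_linear[OF DQ(1)] Lz Llam LP)
  define h6 where "h6 y = s y *\<^sub>R Cs (P y) + lam y *\<^sub>R f y + g y *\<^sub>R Cs (zF y)" for y
  have Lh6: "lip_bounded h6" unfolding h6_def
    by (intro lip_bounded_intros lip_bounded_bounded_linear[OF Cs(1)] Lz Llam LP Lf Ls)
  define F where "F y = GAT (h6 y)" for y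
  have LF: "lip_bounded F" unfolding F_def by (rule lip_bounded_bounded_linear[OF GA(2) Lh6])
  define h2 where "h2 y = s y *\<^sub>R C1 (f y) + lam y *\<^sub>R P y + g y *\<^sub>R C1 (zp y) - lam y *\<^sub>R B2 (Q y)" for y
  have Lh2: "lip_bounded h2" unfolding h2_def
    by (intro lip_bounded_intros lip_bounded_bounded_linear[OF C1(1)] lip_bounded_bounded_linear[OF B2(1)]
        Lz Llam LP Lf Ls LQ)
  define p where "p y = GMT (h2 y)" for y
  have Lp: "lip_bounded p" unfolding p_def by (rule lip_bounded_bounded_linear[OF GM(2) Lh2])
  define q where "q y = lam y *\<^sub>R Sq (Q y) - Dq (p y)" for y
  have Lq: "lip_bounded q" unfolding q_def
    by (intro lip_bounded_intros lip_bounded_bounded_linear[OF Sq(1)] lip_bounded_bounded_linear[OF Dq(1)] Llam LQ Lp)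
  define ft where "ft y = GA (g y *\<^sub>R C1 (f y) - s y *\<^sub>R C1 (p y) + lam y *\<^sub>R F y)" for y
  have Lft: "lip_bounded ft" unfolding ft_def
    by (intro lip_bounded_bounded_linear[OF GA(1)] lip_bounded_intros lip_bounded_bounded_linear[OF C1(1)] Lz Ls Llam Lf Lp LF)
  define Pt where "Pt y = GM (g y *\<^sub>R Cs (P y) - s y *\<^sub>R Cs (F y) + lam y *\<^sub>R p y - lam y *\<^sub>R B3 (q y))" for y
  have LPt: "lip_bounded Pt" unfolding Pt_def
    by (intro lip_bounded_bounded_linear[OF GM(1)] lip_bounded_intros lip_bounded_bounded_linear[OF Cs(1)]
        lip_bounded_bounded_linear[OF B3(1)] Lz Ls Llam LP Lp LF Lq)
  \<comment> \<open>\<open>d1\<close> and \<open>d2\<close> are what the solvability conditions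
    contain beyond leading order, divided by \<open>\<mu>\<close>. At a fixed point
    \<open>zf y\<close> equals \<open>\<mu>\<close> times \<open>ft y\<close>, and similarly for the
    others, so inserting the unscaled values performs this division.\<close>
  define d1 where "d1 y = - s1 y * (bet y * S + \<phi>f (Cs (zP y))) + \<phi>f (Cs (Pt y)) + lam y * \<phi>f (ft y)
      + g y * \<phi>f (Cs (F y))" for y
  have Ld1: "lip_bounded d1" unfolding d1_def
    by (intro lip_bounded_intros lip_bounded_bounded_linear[OF \<phi>f(1)] lip_bounded_bounded_linear[OF Cs(1)]
        Lz Llam Lbet LPt Lft LF)
  define d2 where "d2 y = - s1 y * \<phi>P (C1 (f y)) + \<phi>P (C1 (ft y)) + lam y * \<phi>P (Pt y) + g y * \<phi>P (C1 (p y))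
      - lam y * \<phi>P (B2 (lam y *\<^sub>R SQ (q y) - DQ (Pt y)))" for y
  have Ld2: "lip_bounded d2" unfolding d2_def
    by (intro lip_bounded_intros lip_bounded_bounded_linear[OF \<phi>P(1)] lip_bounded_bounded_linear[OF C1(1)]
        lip_bounded_bounded_linear[OF B2(1)] lip_bounded_bounded_linear[OF SQ(1)] lip_bounded_bounded_linear[OF DQ(1)]
        Lz Llam LPt Lft Lf Lp Lq)
  \<comment> \<open>Sum and difference of the conditions are
    \<open>(1 + \<beta>) (S + \<eta> N) + \<mu> (d1 + d2) = 0\<close> and
    \<open>(\<beta> - 1) (S - \<eta> N) + \<mu> (d1 - d2) = 0\<close>. The factors
    \<open>1 + \<beta>\<close> and \<open>S - \<eta> N\<close> tend to \<open>2\<close> and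
    \<open>2 S\<close>, whence the divisors \<open>2 * N\<close> and \<open>2 * S\<close>.\<close>
  define V where "V y = (F y, p y, q y, ft y, Pt y, (- 1 / (2 * N)) * (d1 y + d2 y), (- 1 / (2 * S)) * (d1 y - d2 y))" for y
  have LV: "lip_bounded V" unfolding V_def
    by (intro lip_bounded_Pair lip_bounded_intros LF Lp Lq Lft LPt Ld1 Ld2)
  define U :: "unknowns \<Rightarrow> unknowns"
    where "U x = (0, 0, 0, 0, 0,
      (- 1 / 2) * (fst (snd (snd (snd (snd (snd x))))) * snd (snd (snd (snd (snd (snd x)))))),
      N / (2 * S) * (fst (snd (snd (snd (snd (snd x))))) * snd (snd (snd (snd (snd (snd x)))))))" for x
  have LU: "lip_bounded U" unfolding U_def
    by (intro lip_bounded_Pair lip_bounded_intros lip_bounded_fst lip_bounded_snd lip_bounded_ident)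
  obtain R m0 where R: "R > 0" "m0 > 0" "\<And>\<mu> r. 0 \<le> \<mu> \<Longrightarrow> \<mu> \<le> m0 \<Longrightarrow> norm r \<le> 3 \<Longrightarrow>
       \<exists>x. norm x \<le> R \<and> V (r, \<mu> *\<^sub>R x) + \<mu> *\<^sub>R U x = x"
    using small_parameter_fixed_point[OF LV LU, of 3] by blast
  \<comment> \<open>The last bound keeps the correction to \<open>f0 0\<close> within half its size,
    so the eigenvector cannot vanish.\<close>
  define \<mu>0 where "\<mu>0 = min (min m0 1) (f0 0 / (2 * R))"
  have \<mu>0: "\<mu>0 > 0" using R f0_pos[of 0] by (simp add: \<mu>0_def)
  note lin = bounded_linear.linear
  note lin_simps = linear_add[OF lin] linear_diff[OF lin] linear_scale[OF lin]
  show ?thesis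
  proof (rule that[OF l0(2) R(1) \<mu>0], intro allI impI, elim conjE)
    fix \<mu> s1' g' :: real
    assume \<mu>: "0 \<le> \<mu>" "\<mu> \<le> \<mu>0" and s1': "\<bar>s1'\<bar> \<le> 1" and g': "\<bar>g'\<bar> \<le> 1"
    have m: "\<mu> \<le> m0" "\<mu> \<le> 1" "\<mu> * R \<le> f0 0 / 2"
    proof -
      have "\<mu> \<le> f0 0 / (2 * R)" using \<mu> by (simp add: \<mu>0_def)
      then show "\<mu> * R \<le> f0 0 / 2" using R(1) by (simp add: field_simps)
    qed (use \<mu> in \<open>auto simp: \<mu>0_def\<close>)
    have "norm (\<mu>, s1', g') \<le> 3"
      using norm_Pair_le[of \<mu> "(s1', g')"] norm_Pair_le[of s1' g'] \<mu> m s1' g' by simp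
    then obtain x where x: "norm x \<le> R" "V ((\<mu>, s1', g'), \<mu> *\<^sub>R x) + \<mu> *\<^sub>R U x = x"
      using R(3)[OF \<mu>(1) m(1)] by blast
    obtain xF xp xq xf xP xl xb where xx: "x = (xF, xp, xq, xf, xP, xl, xb)"
      by (metis surj_pair)
    define y where "y = ((\<mu>, s1', g'), \<mu> *\<^sub>R x)"
    have z: "mu y = \<mu>" "s1 y = s1'" "g y = g'" "zF y = \<mu> *\<^sub>R xF" "zp y = \<mu> *\<^sub>R xp" "zq y = \<mu> *\<^sub>R xq"
      "zf y = \<mu> *\<^sub>R xf" "zP y = \<mu> *\<^sub>R xP" "zl y = \<mu> * xl" "zb y = \<mu> * xb"
      by (simp_all add: z_defs y_def xx)
    have fix_eq: "F y = xF" "p y = xp" "q y = xq" "ft y = xf" "Pt y = xP"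
      "(- 1 / (2 * N)) * (d1 y + d2 y) + \<mu> * ((- 1 / 2) * (xl * xb)) = xl"
      "(- 1 / (2 * S)) * (d1 y - d2 y) + \<mu> * (N / (2 * S) * (xl * xb)) = xb"
      using x(2) unfolding y_def[symmetric] unfolding V_def U_def xx by simp_all
    have sl: "s y = 1 - \<mu> * s1'" "lam y = \<eta>0 + \<mu> * xl" "bet y = 1 + \<mu> * xb"
      by (simp_all add: s_def lam_def bet_def z)
    have "norm xl \<le> R"
      using x(1) norm_snd_le[where x=xF and y="(xp, xq, xf, xP, xl, xb)"]
        norm_snd_le[where x=xp and y="(xq, xf, xP, xl, xb)"] norm_snd_le[where x=xq and y="(xf, xP, xl, xb)"]
        norm_snd_le[where x=xf and y="(xP, xl, xb)"] norm_snd_le[where x=xP and y="(xl, xb)"]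
        norm_fst_le[where x=xl and y=xb] unfolding xx by linarith
    then have lam_le: "\<bar>lam y - \<eta>0\<bar> \<le> R * \<mu>"
      using mult_left_mono[of "\<bar>xl\<bar>" R \<mu>] \<mu> by (simp add: sl abs_mult mult.commute)
    have "norm xf \<le> R"
      using x(1) norm_snd_le[where x=xF and y="(xp, xq, xf, xP, xl, xb)"]
        norm_snd_le[where x=xp and y="(xq, xf, xP, xl, xb)"] norm_snd_le[where x=xq and y="(xf, xP, xl, xb)"]
        norm_fst_le[where x=xf and y="(xP, xl, xb)"] unfolding xx by linarith
    then have "\<bar>sq xf 0\<bar> \<le> R" using sq_bound[of xf 0] by simp
    then have "\<bar>\<mu> * sq xf 0\<bar> \<le> \<mu> * R" using \<mu>(1) by (simp add: abs_mult mult_left_mono)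
    then have f_nz: "sq (f y) 0 \<noteq> 0"
      using m(3) f0_pos[of 0] by (simp add: f_def z sq_add sq_scaleR fe)

    have D1: "\<phi>f (h6 y) = bet y * S + lam y * N + \<mu> * d1 y"
      unfolding h6_def f_def P_def d1_def sl(1) z fix_eq
      by (simp add: lin_simps[OF \<phi>f(1)] lin_simps[OF Cs(1)] S_eq N_def[symmetric] algebra_simps)
    have D2: "\<phi>P (h2 y) = S + lam y * (bet y * N) + \<mu> * d2 y"
    proof -
      have "\<phi>P (h2 y) = s y * \<phi>P (C1 (f y)) + lam y * \<phi>P (P y) + g' * \<mu> * \<phi>P (C1 xp)
          - lam y * \<phi>P (B2 (Q y))"
        unfolding h2_def z by (simp add: lin_simps[OF \<phi>P(1)] lin_simps[OF C1(1)])
      moreover have "\<phi>P (C1 (f y)) = S + \<mu> * \<phi>P (C1 xf)"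
        unfolding f_def z by (simp add: lin_simps[OF \<phi>P(1)] lin_simps[OF C1(1)] S_def)
      moreover have "\<phi>P (P y) = bet y * \<phi>P Pe + \<mu> * \<phi>P xP"
        unfolding P_def z by (simp add: lin_simps[OF \<phi>P(1)])
      moreover have "\<phi>P (B2 (Q y)) = \<mu> * \<phi>P (B2 (lam y *\<^sub>R SQ xq - DQ xP)) - bet y * \<phi>P (B2 (DQ Pe))"
        unfolding Q_def P_def z
        by (simp add: lin_simps[OF \<phi>P(1)] lin_simps[OF B2(1)] lin_simps[OF SQ(1)] lin_simps[OF DQ(1)] algebra_simps)
      ultimately show ?thesis
        unfolding d2_def z fix_eq N_eq[symmetric] sl(1) by (simp add: algebra_simps)
    qed
    have "d1 y + d2 y = - (2 * N * xl) - \<mu> * N * (xl * xb)"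
      using fix_eq(6) N_pos by (simp add: field_simps)
    moreover have "d1 y - d2 y = - (2 * S * xb) + \<mu> * N * (xl * xb)"
      using fix_eq(7) S_pos by (simp add: field_simps)
    moreover have Sl: "S = - (\<eta>0 * N)" using l0 by linarith
    ultimately have "\<phi>f (h6 y) + \<phi>P (h2 y) = 0" "\<phi>f (h6 y) - \<phi>P (h2 y) = 0"
    proof -
      assume a: "d1 y + d2 y = - (2 * N * xl) - \<mu> * N * (xl * xb)"
        and b: "d1 y - d2 y = - (2 * S * xb) + \<mu> * N * (xl * xb)"
      have "\<phi>f (h6 y) + \<phi>P (h2 y) = (1 + bet y) * (S + lam y * N) + \<mu> * (d1 y + d2 y)"
        unfolding D1 D2 by (simp add: algebra_simps)
      also have "\<dots> = 0" unfolding a sl Sl by (simp add: algebra_simps)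
      finally show "\<phi>f (h6 y) + \<phi>P (h2 y) = 0" .
      have "\<phi>f (h6 y) - \<phi>P (h2 y) = (bet y - 1) * (S - lam y * N) + \<mu> * (d1 y - d2 y)"
        unfolding D1 D2 by (simp add: algebra_simps)
      also have "\<dots> = 0" unfolding b sl Sl by (simp add: algebra_simps)
      finally show "\<phi>f (h6 y) - \<phi>P (h2 y) = 0" .
    qed
    \<comment> \<open>With both conditions met, the defects at site \<open>0\<close> drop out of the
      two transposed Green identities.\<close>
    then have D0: "(\<Sum>\<^sub>\<infinity>m. f0 m * sq (h6 y) m) = 0" "(\<Sum>\<^sub>\<infinity>m. P0 m * sq (h2 y) m) = 0"
      by (simp_all add: \<phi>f(2)[symmetric] \<phi>P(2)[symmetric])

    have q_at: "d n * sq xq n = lam y * sq (Q y) (n + 2) - 2 * b (n + 2) * sq xp (n + 2)" for n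
    proof -
      have "sq (q y) n = lam y * (1 / d n * sq (Q y) (n + 2)) - 2 * (b (n + 2) / d n) * sq xp (n + 2)"
        unfolding q_def by (simp only: sq_diff sq_scaleR Sq(2) Dq(2) fix_eq)
      then show ?thesis unfolding fix_eq using d_pos[of n] by (simp add: field_simps)
    qed
    have Q_at: "d n * sq (Q y) (n + 2) = \<mu> * lam y * sq xq n - 2 * b n * sq (P y) n" for n
    proof -
      have "sq (Q y) (n + 2) = lam y * (1 / d n * (\<mu> * sq xq n)) - 2 * (b n / d n) * sq (P y) n"
        unfolding Q_def z by (simp add: sq_diff sq_scaleR SQ(2) DQ(2))
      then show ?thesis using d_pos[of n] by (simp add: field_simps)
    qed
    have e1: "c n * sq (f y) (n + 1) - b n * sq (f y) n
        = \<mu> * (g' * c n * sq (f y) (n + 1) - (1 - \<mu> * s1') * c n * sq xp (n + 1) + lam y * sq xF n)" for n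
    proof -
      have f: "sq (f y) n = f0 n + \<mu> * sq xf n" for n by (simp add: f_def z sq_add sq_scaleR fe)
      have "c n * sq xf (n + 1) - b n * sq xf n
          = g' * (c n * sq (f y) (n + 1)) - s y * (c n * sq xp (n + 1)) + lam y * sq xF n"
        using GA(3)[of n "g y *\<^sub>R C1 (f y) - s y *\<^sub>R C1 (p y) + lam y *\<^sub>R F y"]
        unfolding ft_def[symmetric] unfolding fix_eq z by (simp add: sq_add sq_diff sq_scaleR C1)
      moreover have "c n * sq (f y) (n + 1) - b n * sq (f y) n = \<mu> * (c n * sq xf (n + 1) - b n * sq xf n)"
        unfolding f using f0_rec[of n] by (simp add: algebra_simps)
      ultimately show ?thesis by (simp add: sl mult.assoc)
    qed
    have e2: "b n * (sq xp n + sq xq n) + c n * sq xp (n + 1)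
        = (1 - \<mu> * s1') * c n * sq (f y) (n + 1) + lam y * sq (P y) n + \<mu> * g' * c n * sq xp (n + 1)" for n
    proof -
      have "b n * sq xp n + c n * sq xp (n + 1) - 2 * b n * b (n + 2) / d n * sq xp (n + 2) = sq (h2 y) n"
        using GM(4)[of n "h2 y"] unfolding p_def[symmetric] fix_eq D0 by simp
      also have "sq (h2 y) n = s y * (c n * sq (f y) (n + 1)) + lam y * sq (P y) n
          + g' * (c n * (\<mu> * sq xp (n + 1))) - lam y * (b n / d n * sq (Q y) (n + 2))"
        unfolding h2_def z by (simp add: sq_add sq_diff sq_scaleR C1 B2)
      finally have 1: "b n * sq xp n + c n * sq xp (n + 1)
        + b n / d n * (lam y * sq (Q y) (n + 2) - 2 * b (n + 2) * sq xp (n + 2))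
        = s y * (c n * sq (f y) (n + 1)) + lam y * sq (P y) n + g' * (c n * (\<mu> * sq xp (n + 1)))"
        by (simp add: algebra_simps)
      have "b n / d n * (lam y * sq (Q y) (n + 2) - 2 * b (n + 2) * sq xp (n + 2)) = b n * sq xq n"
        unfolding q_at[symmetric] using d_pos[of n] by simp
      then show ?thesis using 1 by (simp add: sl distrib_left mult_ac)
    qed
    have e3: "2 * b n * sq xp n + d (n - 2) * sq xq (n - 2) = lam y * sq (Q y) n" for n
      using q_at[of "n - 2"] by simp
    have e4: "b n * (sq (P y) n + sq (Q y) n) + c (n - 1) * sq (P y) (n - 1)
        = \<mu> * (g' * c (n - 1) * sq (P y) (n - 1) - (1 - \<mu> * s1') * c (n - 1) * sq xF (n - 1) + lam y * sq xp n)" for n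
    proof -
      have P: "sq (P y) n = bet y * P0 n + \<mu> * sq xP n" for n by (simp add: P_def z sq_add sq_scaleR Pe)
      have X: "b n * sq xP n + c (n - 1) * sq xP (n - 1) - 2 * b n * b (n - 2) / d (n - 2) * sq xP (n - 2)
         = g' * (c (n - 1) * sq (P y) (n - 1)) - s y * (c (n - 1) * sq xF (n - 1)) + lam y * sq xp n
           - lam y * (b n / d (n - 2) * sq xq (n - 2))"
        using GM(3)[of n "g y *\<^sub>R Cs (P y) - s y *\<^sub>R Cs (F y) + lam y *\<^sub>R p y - lam y *\<^sub>R B3 (q y)"]
        unfolding Pt_def[symmetric] unfolding fix_eq z by (simp add: sq_add sq_diff sq_scaleR Cs B3)
      have PX: "b n * sq (P y) n + c (n - 1) * sq (P y) (n - 1) - 2 * b n * b (n - 2) / d (n - 2) * sq (P y) (n - 2)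
        = \<mu> * (b n * sq xP n + c (n - 1) * sq xP (n - 1) - 2 * b n * b (n - 2) / d (n - 2) * sq xP (n - 2))"
      proof -
        have "b n * sq (P y) n + c (n - 1) * sq (P y) (n - 1) - 2 * b n * b (n - 2) / d (n - 2) * sq (P y) (n - 2)
          = bet y * (b n * P0 n + c (n - 1) * P0 (n - 1) - 2 * b n * b (n - 2) / d (n - 2) * P0 (n - 2))
           + \<mu> * (b n * sq xP n + c (n - 1) * sq xP (n - 1) - 2 * b n * b (n - 2) / d (n - 2) * sq xP (n - 2))"
          unfolding P by (simp add: algebra_simps add_divide_distrib)
        then show ?thesis unfolding P0_rec by simp
      qed
      have QX: "b n * sq (Q y) n = \<mu> * (lam y * (b n / d (n - 2) * sq xq (n - 2)))
          - 2 * b n * b (n - 2) / d (n - 2) * sq (P y) (n - 2)"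
      proof -
        have "sq (Q y) n = (\<mu> * lam y * sq xq (n - 2) - 2 * b (n - 2) * sq (P y) (n - 2)) / d (n - 2)"
          using Q_at[of "n - 2"] d_pos[of "n - 2"] by (simp add: field_simps)
        then show ?thesis by (simp only:) (simp add: algebra_simps diff_divide_distrib)
      qed
      have "b n * (sq (P y) n + sq (Q y) n) + c (n - 1) * sq (P y) (n - 1)
        = (b n * sq (P y) n + c (n - 1) * sq (P y) (n - 1) - 2 * b n * b (n - 2) / d (n - 2) * sq (P y) (n - 2))
          + (b n * sq (Q y) n + 2 * b n * b (n - 2) / d (n - 2) * sq (P y) (n - 2))"
        by (simp add: distrib_left)
      also have "\<dots> = \<mu> * (g' * (c (n - 1) * sq (P y) (n - 1)) - s y * (c (n - 1) * sq xF (n - 1)) + lam y * sq xp n)"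
        unfolding PX X QX by (simp add: right_diff_distrib distrib_left)
      finally show ?thesis by (simp add: sl mult.assoc)
    qed
    have e5: "2 * b n * sq (P y) n + d n * sq (Q y) (n + 2) = \<mu> * lam y * sq xq n" for n
      using Q_at[of n] by simp
    have e6: "c (n - 1) * sq xF (n - 1) - b n * sq xF n
        = (1 - \<mu> * s1') * c (n - 1) * sq (P y) (n - 1) + lam y * sq (f y) n + \<mu> * g' * c (n - 1) * sq xF (n - 1)" for n
    proof -
      have "c (n - 1) * sq xF (n - 1) - b n * sq xF n = sq (h6 y) n"
        using GA(4)[of n "h6 y"] unfolding F_def[symmetric] fix_eq D0 by simp
      also have "\<dots> = s y * (c (n - 1) * sq (P y) (n - 1)) + lam y * sq (f y) n
          + g' * (c (n - 1) * (\<mu> * sq xF (n - 1)))"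
        unfolding h6_def z by (simp add: sq_add sq_scaleR Cs)
      finally show ?thesis by (simp add: sl mult_ac)
    qed
    show "\<exists>\<eta> f p q P Q F. \<bar>\<eta> - \<eta>0\<bar> \<le> R * \<mu> \<and> sq f 0 \<noteq> 0 \<and>
        perturbed_system \<mu> (1 - \<mu> * s1') g' \<eta> (sq f) (sq p) (sq q) (sq P) (sq Q) (sq F)"
    proof (intro exI conjI)
      show "perturbed_system \<mu> (1 - \<mu> * s1') g' (lam y) (sq (f y)) (sq xp) (sq xq) (sq (P y)) (sq (Q y)) (sq xF)"
        unfolding perturbed_system_def by (intro allI conjI e1 e2 e3 e4 e5 e6)
    qed (fact lam_le f_nz)+
  qed
qed

end

section \<open>Eigenvalues\<close>

text \<open>The relabelling \<open>j \<mapsto> 7 - j\<close> accompanies the reflection and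
  exchanges the sublattices. The coefficients \<open>c\<close> and \<open>d\<close> sit on bonds of
  length one and two, so their indices go to \<open>- n - 2\<close> and
  \<open>- n - 3\<close>.\<close>

lemma is_eigenvalue_H_II_reflect:
  assumes "is_eigenvalue_H_II bp bm dp dm cc k E"
  shows "is_eigenvalue_H_II bm bp dm dp cc (- k) E"
proof -
  obtain w where w: "l2_C6 w" "\<exists>n. \<exists>j\<in>{1..6}. w n j \<noteq> 0"
    "\<And>n j. j \<in> {1..6} \<Longrightarrow> H_II bp bm dp dm cc k w n j = complex_of_real E * w n j"
    using assms unfolding is_eigenvalue_H_II_def by blast
  define v where "v n j = w (- 1 - n) (7 - j)" for n j
  have six: "{1..6::nat} = {1, 2, 3, 4, 5, 6}" by auto
  have coefs: "coef_b bm bp n = coef_b bp bm (- 1 - n)"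
    "coef_c bm bp dm dp cc n = coef_c bp bm dp dm cc (- n - 2)"
    "coef_d bm bp dm dp cc n = coef_d bp bm dp dm cc (- n - 3)" for n
    by (auto simp: coef_b_def coef_c_def coef_d_def)
  have H: "H_II bm bp dm dp cc (- k) v n j = H_II bp bm dp dm cc k w (- 1 - n) (7 - j)"
    if "j \<in> {1..6}" for n j
    using that unfolding six coefs H_II_def Let_def v_def by (auto simp: algebra_simps)
  have "l2_C6 v"
  proof -
    have bij: "bij_betw (\<lambda>n::int. - 1 - n) UNIV UNIV"
      by (rule bij_betwI[of _ _ _ "\<lambda>n. - 1 - n"]) auto
    have "(\<Sum>j\<in>{1..6}. (cmod (v n j))\<^sup>2) = (\<Sum>j\<in>{1..6}. (cmod (w (- 1 - n) j))\<^sup>2)" for n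
      unfolding six v_def by simp
    then show ?thesis
      using w(1) summable_on_reindex_bij_betw[OF bij, of "\<lambda>n. \<Sum>j\<in>{1..6}. (cmod (w n j))\<^sup>2"]
      unfolding l2_C6_def by simp
  qed
  moreover have "\<exists>n. \<exists>j\<in>{1..6}. v n j \<noteq> 0"
  proof -
    obtain n j where "j \<in> {1..6}" "w n j \<noteq> 0" using w(2) by blast
    then have "7 - j \<in> {1..6}" "v (- 1 - n) (7 - j) \<noteq> 0" by (auto simp: v_def)
    then show ?thesis by blast
  qed
  moreover have "H_II bm bp dm dp cc (- k) v n j = complex_of_real E * v n j" if "j \<in> {1..6}" for n j
    unfolding H[OF that] using that by (subst w(3)) (auto simp: v_def)
  ultimately show ?thesis unfolding is_eigenvalue_H_II_def by blast
qed

section \<open>Reduction to real sequences and the pair of eigenvalues\<close>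

context interface
begin

text \<open>In the gauge \<open>e\<^bsup>i\<kappa>n\<^esup>\<close> the Hamiltonian commutes with complex conjugation composed with the
  exchange \<open>1 \<leftrightarrow> 3\<close>, \<open>4 \<leftrightarrow> 6\<close>; hence the eigenvalue equation reduces to real sequences. The sign
  \<open>\<tau>\<close> is the chiral symmetry.\<close>

lemma is_eigenvalue_H_II_real:
  fixes f p q P Q F :: "int \<Rightarrow> real"
  assumes decay: "0 \<le> r" "r < 1" "\<And>n. \<bar>f n\<bar> \<le> C * r ^ nat \<bar>n\<bar>" "\<And>n. \<bar>p n\<bar> \<le> C * r ^ nat \<bar>n\<bar>"
      "\<And>n. \<bar>q n\<bar> \<le> C * r ^ nat \<bar>n\<bar>" "\<And>n. \<bar>P n\<bar> \<le> C * r ^ nat \<bar>n\<bar>"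
      "\<And>n. \<bar>Q n\<bar> \<le> C * r ^ nat \<bar>n\<bar>" "\<And>n. \<bar>F n\<bar> \<le> C * r ^ nat \<bar>n\<bar>"
    and nz: "f 0 \<noteq> 0" and \<tau>: "\<tau> * \<tau> = 1"
    and e1: "\<And>n. c n * (cos \<kappa> * f (n + 1) + sin \<kappa> * p (n + 1)) - b n * f n = E * F n"
    and e2: "\<And>n. b n * (p n + q n) + c n * (cos \<kappa> * p (n + 1) - sin \<kappa> * f (n + 1)) = E * P n"
    and e3: "\<And>n. 2 * b n * p n + d (n - 2) * q (n - 2) = E * Q n"
    and e4: "\<And>n. b n * (P n + Q n) + c (n - 1) * (cos \<kappa> * P (n - 1) + sin \<kappa> * F (n - 1)) = E * p n"
    and e5: "\<And>n. 2 * b n * P n + d n * Q (n + 2) = E * q n"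
    and e6: "\<And>n. c (n - 1) * (cos \<kappa> * F (n - 1) - sin \<kappa> * P (n - 1)) - b n * F n = E * f n"
  shows "is_eigenvalue_H_II bp bm dp dm cc (2 * \<kappa>) (- (\<tau> * E))"
proof -
  define e where "e n = cis (\<kappa> * of_int n)" for n :: int
  define a where "a n j = (if j = 1 then complex_of_real \<tau> * Complex (P n) (- F n)
      else if j = 2 then complex_of_real \<tau> * Complex (Q n) 0
      else if j = 3 then complex_of_real \<tau> * Complex (P n) (F n)
      else if j = 4 then Complex (p n) (f n)
      else if j = 5 then Complex (q n) 0
      else Complex (p n) (- f n))" for n :: int and j :: nat
  have av: "a n 1 = complex_of_real \<tau> * Complex (P n) (- F n)" "a n 2 = complex_of_real \<tau> * Complex (Q n) 0"
    "a n 3 = complex_of_real \<tau> * Complex (P n) (F n)" "a n 4 = Complex (p n) (f n)"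
    "a n 5 = Complex (q n) 0" "a n 6 = Complex (p n) (- f n)" for n
    by (simp_all add: a_def)
  define w where "w n j = e n * a n j" for n j
  have coefs: "coef_b bp bm n = of_real (b n)" "coef_c bp bm dp dm cc n = of_real (c n)"
    "coef_d bp bm dp dm cc n = of_real (d n)" for n
    by (simp_all add: coef_b_def coef_c_def coef_d_def b_def c_def d_def)
  have ex: "exp (\<i> * complex_of_real (2 * \<kappa>)) = cis (2 * \<kappa>)"
    "exp (- \<i> * complex_of_real (2 * \<kappa>)) = cis (- (2 * \<kappa>))"
    by (simp_all add: cis_conv_exp)
  \<comment> \<open>The phase \<open>2 * \<kappa>\<close> on bonds of length two is absorbed
    completely, and the two kinds of unit bonds receive opposite phases \<open>\<kappa>\<close> and
    \<open>- \<kappa>\<close>; this makes components 1 and 3, and 4 and 6, conjugate.\<close>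
  have shift: "e (n + 1) = e n * cis \<kappa>" "e (n - 1) = e n * cis (- \<kappa>)"
    "cis (- (2 * \<kappa>)) * e (n + 1) = e n * cis (- \<kappa>)" "cis (2 * \<kappa>) * e (n - 1) = e n * cis \<kappa>"
    "cis (- (2 * \<kappa>)) * e (n + 2) = e n" "cis (2 * \<kappa>) * e (n - 2) = e n" for n
    by (simp_all add: e_def cis_mult algebra_simps)
  have \<tau>2: "complex_of_real \<tau> * complex_of_real \<tau> = 1" using \<tau> by (metis of_real_1 of_real_mult)
  let ?t = "complex_of_real \<tau>" and ?E = "complex_of_real E"
  let ?b = "\<lambda>n. complex_of_real (b n)" and ?c = "\<lambda>n. complex_of_real (c n)" and ?d = "\<lambda>n. complex_of_real (d n)"
  \<comment> \<open>Real and imaginary parts are an even and an odd equation: \<open>e2\<close> and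
    \<open>e1\<close> here, \<open>e4\<close> and \<open>e6\<close> in row 4. Rows 3 and 6 are the
    conjugates of rows 1 and 4.\<close>
  have r1: "?b n * Complex (p n) (f n) + ?b n * Complex (q n) 0 + ?c n * cis (- \<kappa>) * Complex (p (n + 1)) (- f (n + 1))
      = ?E * Complex (P n) (- F n)" for n
    using e1[of n] e2[of n] by (simp add: complex_eq_iff algebra_simps)
  have r2: "?b n * Complex (p n) (f n) + ?d (n - 2) * Complex (q (n - 2)) 0 + ?b n * Complex (p n) (- f n)
      = ?E * Complex (Q n) 0" for n
    using e3[of n] by (simp add: complex_eq_iff algebra_simps)
  have r3: "?c n * cis \<kappa> * Complex (p (n + 1)) (f (n + 1)) + ?b n * Complex (q n) 0 + ?b n * Complex (p n) (- f n)
      = ?E * Complex (P n) (F n)" for n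
    using e1[of n] e2[of n] by (simp add: complex_eq_iff algebra_simps)
  have r4: "?b n * Complex (P n) (- F n) + ?b n * Complex (Q n) 0 + ?c (n - 1) * cis (- \<kappa>) * Complex (P (n - 1)) (F (n - 1))
      = ?E * Complex (p n) (f n)" for n
    using e4[of n] e6[of n] by (simp add: complex_eq_iff algebra_simps)
  have r5: "?b n * Complex (P n) (- F n) + ?d n * Complex (Q (n + 2)) 0 + ?b n * Complex (P n) (F n)
      = ?E * Complex (q n) 0" for n
    using e5[of n] by (simp add: complex_eq_iff algebra_simps)
  have r6: "?c (n - 1) * cis \<kappa> * Complex (P (n - 1)) (- F (n - 1)) + ?b n * Complex (Q n) 0 + ?b n * Complex (P n) (F n)
      = ?E * Complex (p n) (- f n)" for n
    using e4[of n] e6[of n] by (simp add: complex_eq_iff algebra_simps)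
  have "H_II bp bm dp dm cc (2 * \<kappa>) w n j = complex_of_real (- (\<tau> * E)) * w n j" if "j \<in> {1..6}" for n j
  proof -
    have "j = 1 \<or> j = 2 \<or> j = 3 \<or> j = 4 \<or> j = 5 \<or> j = 6" using that by auto
    then consider "j = 1" | "j = 2" | "j = 3" | "j = 4" | "j = 5" | "j = 6" by blast
    then show ?thesis
    proof cases
      case 1
      have "H_II bp bm dp dm cc (2 * \<kappa>) w n j
        = - (?b n * w n 4 + ?b n * w n 5 + ?c n * (cis (- (2 * \<kappa>)) * e (n + 1)) * a (n + 1) 6)"
        unfolding H_II_def Let_def coefs ex using 1 by (simp add: w_def mult_ac del: One_nat_def)
      also have "\<dots> = - e n * (?b n * a n 4 + ?b n * a n 5 + ?c n * cis (- \<kappa>) * a (n + 1) 6)"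
        unfolding shift(3) by (simp add: w_def algebra_simps)
      also have "\<dots> = - e n * (?E * Complex (P n) (- F n))" unfolding av r1 by (rule refl)
      \<comment> \<open>The square of \<open>\<tau>\<close> is inserted because the sum over
        components 4 to 6 carries no \<open>\<tau>\<close>, while components 1 to 3 carry
        one.\<close>
      also have "\<dots> = - (?t * ?t) * e n * (?E * Complex (P n) (- F n))" by (simp add: \<tau>2)
      also have "\<dots> = complex_of_real (- (\<tau> * E)) * w n j" by (simp add: w_def av \<open>j = 1\<close> mult_ac del: One_nat_def)
      finally show ?thesis .
    next
      case 2
      have "H_II bp bm dp dm cc (2 * \<kappa>) w n j
        = - (?b n * w n 4 + ?d (n - 2) * (cis (2 * \<kappa>) * e (n - 2)) * a (n - 2) 5 + ?b n * w n 6)"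
        unfolding H_II_def Let_def coefs ex using 2 by (simp add: w_def mult_ac del: One_nat_def)
      also have "\<dots> = - e n * (?b n * a n 4 + ?d (n - 2) * a (n - 2) 5 + ?b n * a n 6)"
        unfolding shift(6) by (simp add: w_def algebra_simps)
      also have "\<dots> = - e n * (?E * Complex (Q n) 0)" unfolding av r2 by (rule refl)
      also have "\<dots> = - (?t * ?t) * e n * (?E * Complex (Q n) 0)" by (simp add: \<tau>2)
      also have "\<dots> = complex_of_real (- (\<tau> * E)) * w n j" by (simp add: w_def av \<open>j = 2\<close> mult_ac del: One_nat_def)
      finally show ?thesis .
    next
      case 3
      have "H_II bp bm dp dm cc (2 * \<kappa>) w n j
        = - (?c n * e (n + 1) * a (n + 1) 4 + ?b n * w n 5 + ?b n * w n 6)"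
        unfolding H_II_def Let_def coefs ex using 3 by (simp add: w_def mult_ac del: One_nat_def)
      also have "\<dots> = - e n * (?c n * cis \<kappa> * a (n + 1) 4 + ?b n * a n 5 + ?b n * a n 6)"
        unfolding shift(1) by (simp add: w_def algebra_simps)
      also have "\<dots> = - e n * (?E * Complex (P n) (F n))" unfolding av r3 by (rule refl)
      also have "\<dots> = - (?t * ?t) * e n * (?E * Complex (P n) (F n))" by (simp add: \<tau>2)
      also have "\<dots> = complex_of_real (- (\<tau> * E)) * w n j" by (simp add: w_def av \<open>j = 3\<close> mult_ac del: One_nat_def)
      finally show ?thesis .
    next
      case 4
      have "H_II bp bm dp dm cc (2 * \<kappa>) w n j
        = - (?b n * w n 1 + ?b n * w n 2 + ?c (n - 1) * e (n - 1) * a (n - 1) 3)"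
        unfolding H_II_def Let_def coefs ex using 4 by (simp add: w_def mult_ac del: One_nat_def)
      also have "\<dots> = - e n * ?t * (?b n * Complex (P n) (- F n) + ?b n * Complex (Q n) 0
          + ?c (n - 1) * cis (- \<kappa>) * Complex (P (n - 1)) (F (n - 1)))"
        unfolding shift(2) by (simp only: w_def av) (simp add: algebra_simps)
      also have "\<dots> = complex_of_real (- (\<tau> * E)) * w n j"
        unfolding r4 by (simp add: w_def av \<open>j = 4\<close> mult_ac del: One_nat_def)
      finally show ?thesis .
    next
      case 5
      have "H_II bp bm dp dm cc (2 * \<kappa>) w n j
        = - (?b n * w n 1 + ?d n * (cis (- (2 * \<kappa>)) * e (n + 2)) * a (n + 2) 2 + ?b n * w n 3)"
        unfolding H_II_def Let_def coefs ex using 5 by (simp add: w_def mult_ac del: One_nat_def)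
      also have "\<dots> = - e n * ?t * (?b n * Complex (P n) (- F n) + ?d n * Complex (Q (n + 2)) 0
          + ?b n * Complex (P n) (F n))"
        unfolding shift(5) by (simp only: w_def av) (simp add: algebra_simps)
      also have "\<dots> = complex_of_real (- (\<tau> * E)) * w n j"
        unfolding r5 by (simp add: w_def av \<open>j = 5\<close> mult_ac del: One_nat_def)
      finally show ?thesis .
    next
      case 6
      have "H_II bp bm dp dm cc (2 * \<kappa>) w n j
        = - (?c (n - 1) * (cis (2 * \<kappa>) * e (n - 1)) * a (n - 1) 1 + ?b n * w n 2 + ?b n * w n 3)"
        unfolding H_II_def Let_def coefs ex using 6 by (simp add: w_def mult_ac del: One_nat_def)
      also have "\<dots> = - e n * ?t * (?c (n - 1) * cis \<kappa> * Complex (P (n - 1)) (- F (n - 1)) + ?b n * Complex (Q n) 0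
          + ?b n * Complex (P n) (F n))"
        unfolding shift(4) by (simp only: w_def av) (simp add: algebra_simps)
      also have "\<dots> = complex_of_real (- (\<tau> * E)) * w n j"
        unfolding r6 by (simp add: w_def av \<open>j = 6\<close> mult_ac del: One_nat_def)
      finally show ?thesis .
    qed
  qed
  moreover have "\<exists>n. \<exists>j\<in>{1..6}. w n j \<noteq> 0"
    using nz by (intro exI[of _ 0] bexI[of _ 4]) (auto simp: w_def a_def e_def complex_eq_iff)
  moreover have "l2_C6 w"
    unfolding l2_C6_def
  proof (rule summable_on_of_geometric_bound[of "r\<^sup>2" _ "6 * (2 * C)\<^sup>2"])
    show "r\<^sup>2 < 1" using decay(1,2) by (simp add: power_less_one_iff)
    have \<tau>1: "\<bar>\<tau>\<bar> = 1"
      using \<tau> by (metis real_sqrt_abs2 real_sqrt_one)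
    show "\<bar>\<Sum>j\<in>{1..6}. (cmod (w n j))\<^sup>2\<bar> \<le> 6 * (2 * C)\<^sup>2 * (r\<^sup>2) ^ nat \<bar>n\<bar>" for n
    proof -
      define K where "K = C * r ^ nat \<bar>n\<bar>"
      note le_K = decay(3-8)[of n, folded K_def]
      have K: "K \<ge> 0" using le_K(1) by linarith
      have le: "cmod (Complex x y) \<le> 2 * K" if "\<bar>x\<bar> \<le> K" "\<bar>y\<bar> \<le> K" for x y
        using cmod_le[of "Complex x y"] that by simp
      have "cmod (a n j) \<le> 2 * K" for j
        by (simp add: a_def norm_mult \<tau>1 le le_K K)
      then have wK: "cmod (w n j) \<le> 2 * K" for j
        by (simp add: w_def e_def norm_mult)
      have "(cmod (w n j))\<^sup>2 \<le> (2 * K)\<^sup>2" for j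
        by (rule power_mono[OF wK norm_ge_zero])
      then have "(\<Sum>j\<in>{1..6::nat}. (cmod (w n j))\<^sup>2) \<le> of_nat (card {1..6::nat}) * (2 * K)\<^sup>2"
        by (intro sum_bounded_above)
      also have "\<dots> = 6 * (2 * C)\<^sup>2 * (r\<^sup>2) ^ nat \<bar>n\<bar>"
        by (simp add: K_def power_mult_distrib flip: power_mult) (simp add: mult.commute)
      finally show ?thesis by (simp add: sum_nonneg)
    qed
  qed simp
  ultimately show ?thesis unfolding is_eigenvalue_H_II_def by blast
qed

text \<open>The sign \<open>\<tau>\<close> yields both \<open>\<kappa> \<eta>\<close> and its
  negative, so \<open>\<bar>\<kappa>\<bar> \<eta>\<close> can be taken for \<open>E\<close>. Its
  error is at most \<open>\<bar>\<kappa>\<bar> R \<mu>\<close>, of third order in \<open>k\<close>,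
  and is then weakened to second order.\<close>

lemma interface_eigenvalues:
  obtains E1 \<epsilon> C :: real where "E1 \<noteq> 0" "\<epsilon> > 0"
    "\<And>k. 0 < \<bar>k\<bar> \<Longrightarrow> \<bar>k\<bar> < \<epsilon> \<Longrightarrow> \<exists>E. E \<noteq> 0 \<and> \<bar>E - E1 * \<bar>k\<bar>\<bar> \<le> C * k\<^sup>2 \<and>
       is_eigenvalue_H_II bp bm dp dm cc k E \<and> is_eigenvalue_H_II bp bm dp dm cc k (- E)"
proof -
  obtain \<rho> f0 P0 W0 where modes: "0 < \<rho>" "\<rho> < 1" "decay_weight \<rho> f0" "decay_weight \<rho> P0" "growth_weight \<rho> W0"
    "\<And>n. c n * f0 (n + 1) = b n * f0 n"
    "\<And>n. b n * P0 n + c (n - 1) * P0 (n - 1) = 2 * b n * b (n - 2) / d (n - 2) * P0 (n - 2)"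
    "\<And>n. W0 n / W0 (n - 1) = 2 * b (n - 2) / d (n - 2) * P0 (n - 2) / P0 (n - 1)"
    "(\<Sum>\<^sub>\<infinity>n. f0 n * f0 n) = (\<Sum>\<^sub>\<infinity>n. P0 n * ((1 + 2 * (b n / d n)\<^sup>2) * P0 n))"
    using zero_modes by blast
  define \<sigma> where "\<sigma> = (1 + \<rho>) / 2"
  interpret interface_modes bp bm dp dm cc \<rho> \<sigma> f0 P0 W0
  proof unfold_locales
    show "0 < \<rho>" "\<rho> < \<sigma>" "\<sigma> < 1" using modes(1,2) by (auto simp: \<sigma>_def)
  qed (fact modes)+
  obtain \<eta>0 R \<mu>0 where sol: "\<eta>0 \<noteq> 0" "R > 0" "\<mu>0 > 0"
    "\<forall>\<mu> s1 g. 0 \<le> \<mu> \<and> \<mu> \<le> \<mu>0 \<and> \<bar>s1\<bar> \<le> 1 \<and> \<bar>g\<bar> \<le> 1 \<longrightarrow>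
      (\<exists>\<eta> f p q P Q F. \<bar>\<eta> - \<eta>0\<bar> \<le> R * \<mu> \<and> sq f 0 \<noteq> 0 \<and>
        perturbed_system \<mu> (1 - \<mu> * s1) g \<eta> (sq f) (sq p) (sq q) (sq P) (sq Q) (sq F))"
    by (rule perturbed_solution)
  \<comment> \<open>The last bound keeps \<open>\<eta>\<close> within half of
    \<open>\<bar>\<eta>0\<bar>\<close> from \<open>\<eta>0\<close>; hence \<open>E\<close> is
    nonzero and the two eigenvalues differ.\<close>
  define m where "m = min (min \<mu>0 1) (\<bar>\<eta>0\<bar> / (2 * R))"
  have m: "m > 0" "m \<le> \<mu>0" "m \<le> 1" "R * m \<le> \<bar>\<eta>0\<bar> / 2"
  proof -
    have "m \<le> \<bar>\<eta>0\<bar> / (2 * R)" by (simp add: m_def)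
    then show "R * m \<le> \<bar>\<eta>0\<bar> / 2" using sol(2) by (simp add: field_simps)
  qed (use sol in \<open>auto simp: m_def\<close>)
  show ?thesis
  proof (rule that[of "\<eta>0 / 2" m R])
    fix k :: real
    assume k: "0 < \<bar>k\<bar>" "\<bar>k\<bar> < m"
    define \<kappa> where "\<kappa> = k / 2"
    define \<mu> where "\<mu> = \<kappa> * \<kappa>"
    define g where "g = (1 - cos \<kappa>) / \<mu>"
    define s1 where "s1 = (1 - sin \<kappa> / \<kappa>) / \<mu>"
    have \<kappa>: "\<kappa> \<noteq> 0" "\<bar>\<kappa>\<bar> < m" "k = 2 * \<kappa>" using k by (auto simp: \<kappa>_def)
    have \<mu>: "\<mu> > 0" "\<mu> \<le> m"
    proof -
      show "\<mu> > 0" using \<kappa>(1) by (auto simp: \<mu>_def zero_less_mult_iff linorder_neq_iff)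
      have "\<bar>\<kappa>\<bar> * \<bar>\<kappa>\<bar> \<le> m * 1" using \<kappa>(2) m(3) by (intro mult_mono) auto
      then show "\<mu> \<le> m" by (simp add: \<mu>_def)
    qed
    have cos: "cos \<kappa> = 1 - \<mu> * g" using \<mu> by (simp add: g_def)
    have sin: "sin \<kappa> = \<kappa> * (1 - \<mu> * s1)" using \<mu> \<kappa>(1) by (simp add: s1_def)
    have g1: "\<bar>g\<bar> \<le> 1"
    proof -
      have "1 - cos \<kappa> = 2 * (sin (\<kappa> / 2))\<^sup>2" using cos_double_sin[of "\<kappa> / 2"] by simp
      moreover have "(sin (\<kappa> / 2))\<^sup>2 \<le> (\<kappa> / 2)\<^sup>2"
        using abs_sin_x_le_abs_x[of "\<kappa> / 2"] unfolding abs_le_square_iff .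
      ultimately have "0 \<le> 1 - cos \<kappa>" "1 - cos \<kappa> \<le> \<mu>"
        using \<mu>(1) by (auto simp: \<mu>_def power2_eq_square)
      then show ?thesis using \<mu>(1) by (simp add: g_def)
    qed
    have s11: "\<bar>s1\<bar> \<le> 1"
    proof -
      have "(\<Sum>i<3. sin_coeff i * \<kappa> ^ i) = \<kappa>" by (simp add: numeral_3_eq_3 sin_coeff_def)
      then have "\<bar>sin \<kappa> - \<kappa>\<bar> \<le> inverse (fact 3) * \<bar>\<kappa>\<bar> ^ 3"
        using Maclaurin_sin_bound[of \<kappa> 3] by simp
      also have "\<dots> \<le> 1 * \<bar>\<kappa>\<bar> ^ 3" by (intro mult_right_mono) (auto simp: fact_numeral)
      finally have "\<bar>sin \<kappa> - \<kappa>\<bar> \<le> \<mu> * \<bar>\<kappa>\<bar>" by (simp add: \<mu>_def power3_eq_cube)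
      moreover have "sin \<kappa> - \<kappa> = - (\<kappa> * \<mu> * s1)" unfolding sin by (simp add: algebra_simps)
      ultimately have "(\<mu> * \<bar>\<kappa>\<bar>) * \<bar>s1\<bar> \<le> (\<mu> * \<bar>\<kappa>\<bar>) * 1"
        using \<mu>(1) by (simp add: abs_mult mult_ac)
      moreover have "\<mu> * \<bar>\<kappa>\<bar> > 0" using \<mu>(1) \<kappa>(1) by simp
      ultimately show ?thesis by (simp only: mult_le_cancel_left_pos)
    qed
    obtain \<eta> f p q P Q F where s: "\<bar>\<eta> - \<eta>0\<bar> \<le> R * \<mu>" "sq f 0 \<noteq> 0"
      and sys: "perturbed_system \<mu> (1 - \<mu> * s1) g \<eta> (sq f) (sq p) (sq q) (sq P) (sq Q) (sq F)"
      using sol(4) less_imp_le[OF \<mu>(1)] order_trans[OF \<mu>(2) m(2)] s11 g1 by blast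
    note sys_n = sys[unfolded perturbed_system_def, THEN spec]
    note sys1 = sys_n[THEN conjunct1]
    note sys2 = sys_n[THEN conjunct2, THEN conjunct1]
    note sys3 = sys_n[THEN conjunct2, THEN conjunct2, THEN conjunct1]
    note sys4 = sys_n[THEN conjunct2, THEN conjunct2, THEN conjunct2, THEN conjunct1]
    note sys5 = sys_n[THEN conjunct2, THEN conjunct2, THEN conjunct2, THEN conjunct2, THEN conjunct1]
    note sys6 = sys_n[THEN conjunct2, THEN conjunct2, THEN conjunct2, THEN conjunct2, THEN conjunct2]
    define C where "C = norm f + norm (\<kappa> *\<^sub>R p) + norm (\<kappa> *\<^sub>R q) + norm P + norm Q + norm (\<kappa> *\<^sub>R F)"
    have bound: "\<bar>sq x n\<bar> \<le> C * \<sigma> ^ nat \<bar>n\<bar>" if "norm x \<le> C" for x n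
      using order_trans[OF sq_bound[of x n] mult_right_mono[OF that]] sigma_pos by simp
    have eig: "is_eigenvalue_H_II bp bm dp dm cc (2 * \<kappa>) (- (\<tau> * (\<kappa> * \<eta>)))" if "\<tau> * \<tau> = 1" for \<tau>
    proof (rule is_eigenvalue_H_II_real[where f="sq f" and p="sq (\<kappa> *\<^sub>R p)" and q="sq (\<kappa> *\<^sub>R q)"
        and P="sq P" and Q="sq Q" and F="sq (\<kappa> *\<^sub>R F)" and C=C and r=\<sigma>])
      show "0 \<le> \<sigma>" "\<sigma> < 1" using sigma_pos sigma_less by auto
      show "\<bar>sq f n\<bar> \<le> C * \<sigma> ^ nat \<bar>n\<bar>" "\<bar>sq (\<kappa> *\<^sub>R p) n\<bar> \<le> C * \<sigma> ^ nat \<bar>n\<bar>"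
        "\<bar>sq (\<kappa> *\<^sub>R q) n\<bar> \<le> C * \<sigma> ^ nat \<bar>n\<bar>" "\<bar>sq P n\<bar> \<le> C * \<sigma> ^ nat \<bar>n\<bar>"
        "\<bar>sq Q n\<bar> \<le> C * \<sigma> ^ nat \<bar>n\<bar>" "\<bar>sq (\<kappa> *\<^sub>R F) n\<bar> \<le> C * \<sigma> ^ nat \<bar>n\<bar>" for n
        by (rule bound, simp add: C_def)+
      show "sq f 0 \<noteq> 0" "\<tau> * \<tau> = 1" by fact+
      show "c n * (cos \<kappa> * sq f (n + 1) + sin \<kappa> * sq (\<kappa> *\<^sub>R p) (n + 1)) - b n * sq f n
          = \<kappa> * \<eta> * sq (\<kappa> *\<^sub>R F) n" for n
        using sys1[of n] unfolding cos sin sq_scaleR \<mu>_def by (simp add: algebra_simps)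
      \<comment> \<open>The second, third and sixth equations are multiplied by
        \<open>\<kappa>\<close> to undo the division of \<open>p\<close>, \<open>q\<close>,
        \<open>F\<close>; in the others \<open>\<mu>\<close> already contains this factor.\<close>
      show "b n * (sq (\<kappa> *\<^sub>R p) n + sq (\<kappa> *\<^sub>R q) n)
          + c n * (cos \<kappa> * sq (\<kappa> *\<^sub>R p) (n + 1) - sin \<kappa> * sq f (n + 1)) = \<kappa> * \<eta> * sq P n" for n
        using arg_cong[OF sys2[of n], of "\<lambda>x. \<kappa> * x"] unfolding cos sin sq_scaleR by (simp add: algebra_simps)
      show "2 * b n * sq (\<kappa> *\<^sub>R p) n + d (n - 2) * sq (\<kappa> *\<^sub>R q) (n - 2) = \<kappa> * \<eta> * sq Q n" for n
        using arg_cong[OF sys3[of n], of "\<lambda>x. \<kappa> * x"] unfolding sq_scaleR by (simp add: algebra_simps)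
      show "b n * (sq P n + sq Q n) + c (n - 1) * (cos \<kappa> * sq P (n - 1) + sin \<kappa> * sq (\<kappa> *\<^sub>R F) (n - 1))
          = \<kappa> * \<eta> * sq (\<kappa> *\<^sub>R p) n" for n
        using sys4[of n] unfolding cos sin sq_scaleR \<mu>_def by (simp add: algebra_simps)
      show "2 * b n * sq P n + d n * sq Q (n + 2) = \<kappa> * \<eta> * sq (\<kappa> *\<^sub>R q) n" for n
        using sys5[of n] unfolding sq_scaleR \<mu>_def by (simp add: algebra_simps)
      show "c (n - 1) * (cos \<kappa> * sq (\<kappa> *\<^sub>R F) (n - 1) - sin \<kappa> * sq P (n - 1)) - b n * sq (\<kappa> *\<^sub>R F) n
          = \<kappa> * \<eta> * sq f n" for n
        using arg_cong[OF sys6[of n], of "\<lambda>x. \<kappa> * x"] unfolding cos sin sq_scaleR by (simp add: algebra_simps)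
    qed
    define E where "E = \<bar>\<kappa>\<bar> * \<eta>"
    have "is_eigenvalue_H_II bp bm dp dm cc k E \<and> is_eigenvalue_H_II bp bm dp dm cc k (- E)"
      using eig[of 1] eig[of "-1"] by (cases "\<kappa> > 0") (auto simp: E_def \<kappa>(3))
    moreover have "E \<noteq> 0"
    proof -
      have "R * \<mu> \<le> R * m" using \<mu> sol(2) by (intro mult_left_mono) auto
      then have "\<bar>\<eta> - \<eta>0\<bar> \<le> \<bar>\<eta>0\<bar> / 2" using s(1) m(4) by linarith
      then have "\<eta> \<noteq> 0" using sol(1) by auto
      then show ?thesis using \<kappa>(1) by (simp add: E_def)
    qed
    moreover have "\<bar>E - \<eta>0 / 2 * \<bar>k\<bar>\<bar> \<le> R * k\<^sup>2"
    proof -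
      have "E - \<eta>0 / 2 * \<bar>k\<bar> = \<bar>\<kappa>\<bar> * (\<eta> - \<eta>0)" by (simp add: E_def \<kappa>(3) abs_mult algebra_simps)
      then have "\<bar>E - \<eta>0 / 2 * \<bar>k\<bar>\<bar> = \<bar>\<kappa>\<bar> * \<bar>\<eta> - \<eta>0\<bar>" by (simp add: abs_mult)
      also have "\<dots> \<le> 1 * (R * \<mu>)" using \<kappa>(2) m(3) s(1) by (intro mult_mono) auto
      also have "\<dots> \<le> R * k\<^sup>2"
        using sol(2) by (simp add: \<kappa>(3) \<mu>_def power2_eq_square)
      finally show ?thesis .
    qed
    ultimately show "\<exists>E. E \<noteq> 0 \<and> \<bar>E - \<eta>0 / 2 * \<bar>k\<bar>\<bar> \<le> R * k\<^sup>2 \<and>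
       is_eigenvalue_H_II bp bm dp dm cc k E \<and> is_eigenvalue_H_II bp bm dp dm cc k (- E)" by blast
  qed (use sol m in auto)
qed

end

theorem theorem15:
  fixes bp bm dp dm cc :: real
  assumes "bp > 0" and "bm > 0" and "bp + dp > 0" and "bm + dm > 0"
    and "dp * dm < 0" and "cc > 0"
  shows "\<exists>E1::real. E1 \<noteq> 0 \<and>
    (\<exists>\<epsilon>>0. \<exists>C. \<exists>Ep Em :: real \<Rightarrow> real. \<forall>k. 0 < \<bar>k\<bar> \<and> \<bar>k\<bar> < \<epsilon> \<longrightarrow>
       Ep k \<noteq> Em k \<and>
       is_eigenvalue_H_II bp bm dp dm cc k (Ep k) \<and>
       is_eigenvalue_H_II bp bm dp dm cc k (Em k) \<and>
       \<bar>Ep k - E1 * \<bar>k\<bar>\<bar> \<le> C * k\<^sup>2 \<and>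
       \<bar>Em k + E1 * \<bar>k\<bar>\<bar> \<le> C * k\<^sup>2)"
proof -
  have "\<exists>E1 \<epsilon> C. E1 \<noteq> 0 \<and> \<epsilon> > 0 \<and> (\<forall>k. 0 < \<bar>k\<bar> \<and> \<bar>k\<bar> < \<epsilon> \<longrightarrow>
      (\<exists>E. E \<noteq> 0 \<and> \<bar>E - E1 * \<bar>k\<bar>\<bar> \<le> C * k\<^sup>2 \<and>
       is_eigenvalue_H_II bp bm dp dm cc k E \<and> is_eigenvalue_H_II bp bm dp dm cc k (- E)))"
  proof (cases "dp > 0")
    case True
    then have "dm < 0" using assms(5) by (simp add: mult_less_0_iff)
    then interpret interface bp bm dp dm cc
      using True assms by unfold_locales
    show ?thesis using interface_eigenvalues by metis
  next
    case False
    then have "dp < 0" "dm > 0" using assms(5) by (auto simp: mult_less_0_iff)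
    then interpret interface bm bp dm dp cc
      using assms by unfold_locales
    obtain E1 \<epsilon> C where *: "E1 \<noteq> 0" "\<epsilon> > 0"
      "\<And>k. 0 < \<bar>k\<bar> \<Longrightarrow> \<bar>k\<bar> < \<epsilon> \<Longrightarrow> \<exists>E. E \<noteq> 0 \<and> \<bar>E - E1 * \<bar>k\<bar>\<bar> \<le> C * k\<^sup>2 \<and>
        is_eigenvalue_H_II bm bp dm dp cc k E \<and> is_eigenvalue_H_II bm bp dm dp cc k (- E)"
      using interface_eigenvalues by metis
    \<comment> \<open>The estimate depends on \<open>k\<close> only through
      \<open>\<bar>k\<bar>\<close> and \<open>k\<^sup>2\<close>, so evaluating at \<open>- k\<close>
      undoes the sign change of the reflection.\<close>
    have "\<exists>E. E \<noteq> 0 \<and> \<bar>E - E1 * \<bar>k\<bar>\<bar> \<le> C * k\<^sup>2 \<and>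
        is_eigenvalue_H_II bp bm dp dm cc k E \<and> is_eigenvalue_H_II bp bm dp dm cc k (- E)"
      if "0 < \<bar>k\<bar>" "\<bar>k\<bar> < \<epsilon>" for k
      using *(3)[of "- k"] that is_eigenvalue_H_II_reflect[of bm bp dm dp cc "- k"] by auto
    then show ?thesis using *(1,2) by blast
  qed
  then obtain E1 \<epsilon> C where *: "E1 \<noteq> 0" "\<epsilon> > 0" "\<forall>k. 0 < \<bar>k\<bar> \<and> \<bar>k\<bar> < \<epsilon> \<longrightarrow>
      (\<exists>E. E \<noteq> 0 \<and> \<bar>E - E1 * \<bar>k\<bar>\<bar> \<le> C * k\<^sup>2 \<and>
       is_eigenvalue_H_II bp bm dp dm cc k E \<and> is_eigenvalue_H_II bp bm dp dm cc k (- E))" by blast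
  then obtain e where e: "\<And>k. 0 < \<bar>k\<bar> \<and> \<bar>k\<bar> < \<epsilon> \<Longrightarrow> e k \<noteq> 0 \<and> \<bar>e k - E1 * \<bar>k\<bar>\<bar> \<le> C * k\<^sup>2 \<and>
       is_eigenvalue_H_II bp bm dp dm cc k (e k) \<and> is_eigenvalue_H_II bp bm dp dm cc k (- e k)" by metis
  have "e k \<noteq> - e k \<and> is_eigenvalue_H_II bp bm dp dm cc k (e k) \<and> is_eigenvalue_H_II bp bm dp dm cc k (- e k) \<and>
       \<bar>e k - E1 * \<bar>k\<bar>\<bar> \<le> C * k\<^sup>2 \<and> \<bar>- e k + E1 * \<bar>k\<bar>\<bar> \<le> C * k\<^sup>2" if "0 < \<bar>k\<bar> \<and> \<bar>k\<bar> < \<epsilon>" for k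
    using e[OF that] by (auto simp: abs_minus_commute)
  then have "\<forall>k. 0 < \<bar>k\<bar> \<and> \<bar>k\<bar> < \<epsilon> \<longrightarrow> e k \<noteq> - e k \<and> is_eigenvalue_H_II bp bm dp dm cc k (e k) \<and>
      is_eigenvalue_H_II bp bm dp dm cc k (- e k) \<and>
      \<bar>e k - E1 * \<bar>k\<bar>\<bar> \<le> C * k\<^sup>2 \<and> \<bar>- e k + E1 * \<bar>k\<bar>\<bar> \<le> C * k\<^sup>2" by blast
  then have "\<exists>Ep Em :: real \<Rightarrow> real. \<forall>k. 0 < \<bar>k\<bar> \<and> \<bar>k\<bar> < \<epsilon> \<longrightarrow>
       Ep k \<noteq> Em k \<and>
       is_eigenvalue_H_II bp bm dp dm cc k (Ep k) \<and>
       is_eigenvalue_H_II bp bm dp dm cc k (Em k) \<and>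
       \<bar>Ep k - E1 * \<bar>k\<bar>\<bar> \<le> C * k\<^sup>2 \<and>
       \<bar>Em k + E1 * \<bar>k\<bar>\<bar> \<le> C * k\<^sup>2"
    by (rule exI[of _ e, OF exI[of _ "\<lambda>k. - e k"]])
  then show ?thesis using *(1,2) by blast
qed

end
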